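(* Let $k \geq 2$ be an integer, let $c > 0$ be real, and let $\star \in \{\leq,<\}$. There does not exist any set $\mathcal{A} \subseteq \mathbb{N}_0$ satisfying \[ \sum_{j=0}^{n} \big( r^{\star}_k(\mathcal{A},j) - c \big) = o\big(n^{1/4}\log^{-1/2} n\big) \quad (n \to \infty). \]
   Context: $\mathbb{N}_0=\{0,1,2,\dots\}$. For $\mathcal{A}\subseteq\mathbb{N}_0$ and $n\ge 0$, the ordered representation functions are $r^{\leq}_k(\mathcal{A},n) = \#\{(a_1,\dots,a_k)\in\mathcal{A}^k : a_1\le\dots\le a_k,\ a_1+\dots+a_k=n\}$ and $r^{<}_k(\mathcal{A},n) = \#\{(a_1,\dots,a_k)\in\mathcal{A}^k : a_1<\dots<a_k,\ a_1+\dots+a_k=n\}$. *)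

theory Defs
  imports Complex_Main "HOL-Library.Landau_Symbols"
begin

text \<open>
  The tuples are lists of length \<open>k\<close>. For the transitive relations \<open>(\<le>)\<close> and \<open>(<)\<close>, \<^const>\<open>sorted_wrt\<close>
  is the chain condition on consecutive entries.
\<close>

definition ordered_rep :: "(nat \<Rightarrow> nat \<Rightarrow> bool) \<Rightarrow> nat \<Rightarrow> nat set \<Rightarrow> nat \<Rightarrow> nat" where
  "ordered_rep R k A n =
     card {as. length as = k \<and> set as \<subseteq> A \<and> sorted_wrt R as \<and> sum_list as = n}"

lemma finite_ordered_rep:
  fixes A :: "nat set"
  shows "finite {as. length as = k \<and> set as \<subseteq> A \<and> sorted_wrt R as \<and> sum_list as = n}"
proof (rule finite_subset)
  show "{as. length as = k \<and> set as \<subseteq> A \<and> sorted_wrt R as \<and> sum_list as = n}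
          \<subseteq> {as. set as \<subseteq> {..n} \<and> length as = k}"
    using member_le_sum_list by fastforce
  show "finite {as. set as \<subseteq> {..n} \<and> length as = k}"
    by (rule finite_lists_length_eq) simp
qed

end

theory Submission
  imports Defs "HOL-Analysis.Analysis" "HOL-Real_Asymp.Real_Asymp"
begin

text \<open>
  Write \<open>f(z)\<close> for the generating function of \<open>A\<close>, \<open>H(z)\<close> for that of the representation function
  and \<open>E(z)\<close> for that of the error sums, so that \<open>H(z) = c/(1-z) + (1-z) E(z)\<close>. Newton's identities
  between (complete or elementary) symmetric functions and the power sums \<open>f(z^i)\<close> show that
  \<open>k! H(z)\<close> and \<open>f(z)^k\<close> differ by \<open>O(1 + sum of |f(z^i)|^(k-1) for i \<le> k)\<close>.

  Integrate \<open>|f|^k |G|^2\<close> over \<open>|z| = r = 1 - 1/N\<close>, where \<open>G(z) = 1/(1-qz)\<close>, \<open>q = 1 - 1/M\<close> and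
  \<open>M = \<epsilon> sqrt N / ln N\<close>, and let \<open>T\<close> be the mean of \<open>|G|^2\<close>, which has order \<open>M\<close>. Parseval's identity
  for \<open>f G\<close>, whose coefficients are nonnegative, gives the lower bound \<open>T f(r^2)^(k/2)\<close>, of
  order \<open>T sqrt N\<close>. In the upper bound, \<open>c/(1-z)\<close> contributes \<open>M^2 ln N\<close>, the error term is handled by
  \<open>|1-z| |G| \<le> 2\<close> and the Parseval identity for \<open>E\<close>, and the lower order terms are absorbed: since
  \<open>|G(z)| \<le> (2i+1) |G(z^i)|\<close>, the Parseval identity for \<open>f^m G\<close> bounds the integrals with \<open>f(z^i)\<close>
  by those with \<open>f(z)\<close>. For small \<open>\<epsilon>\<close> the two bounds contradict each other.
\<close>

subsection \<open>Newton's identities for sorted lists\<close>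

definition sorted_lists :: "(nat \<Rightarrow> nat \<Rightarrow> bool) \<Rightarrow> nat \<Rightarrow> nat set \<Rightarrow> nat list set" where
  "sorted_lists R k S = {as. length as = k \<and> set as \<subseteq> S \<and> sorted_wrt R as}"

text \<open>In the variables \<open>z ^ a\<close> with \<open>a\<close> in \<open>S\<close>, this is
  the complete homogeneous symmetric polynomial of degree \<open>k\<close> when \<open>R\<close> is
  \<open>(\<le>)\<close>, and the elementary one when \<open>R\<close> is
  \<open>(<)\<close>.\<close>

definition sorted_gf :: "(nat \<Rightarrow> nat \<Rightarrow> bool) \<Rightarrow> nat \<Rightarrow> nat set \<Rightarrow> complex \<Rightarrow> complex" where
  "sorted_gf R k S z = (\<Sum>as\<in>sorted_lists R k S. z ^ sum_list as)"

lemma finite_sorted_lists: "finite S \<Longrightarrow> finite (sorted_lists R k S)"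
  unfolding sorted_lists_def
  by (rule finite_subset[OF _ finite_lists_length_eq[of S k]]) auto

lemma sorted_gf_0 [simp]: "sorted_gf R 0 S z = 1"
proof -
  have "sorted_lists R 0 S = {[]}" by (auto simp: sorted_lists_def)
  thus ?thesis by (simp add: sorted_gf_def)
qed

lemma sorted_gf_empty [simp]: "sorted_gf R (Suc k) {} z = 0"
proof -
  have "sorted_lists R (Suc k) {} = {}" by (auto simp: sorted_lists_def)
  thus ?thesis by (simp add: sorted_gf_def)
qed

text \<open>The common part of both recursions below. \<open>S'\<close> is the set from which the
  tail behind a leading \<open>x\<close> is drawn. Since \<open>x \<notin> S\<close>, the two
  families of lists in the last assumption are disjoint and their sums add.\<close>

lemma sorted_gf_insert_aux:
  assumes "finite S" "x \<notin> S" "S' \<subseteq> insert x S"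
    and "sorted_lists R (Suc k) (insert x S) = sorted_lists R (Suc k) S \<union> (#) x ` sorted_lists R k S'"
  shows "sorted_gf R (Suc k) (insert x S) z = sorted_gf R (Suc k) S z + z ^ x * sorted_gf R k S' z"
proof -
  have fin: "finite S'" using assms finite_subset by blast
  have "sorted_lists R (Suc k) S \<inter> (#) x ` sorted_lists R k S' = {}"
    using assms(2) by (auto simp: sorted_lists_def)
  hence "sorted_gf R (Suc k) (insert x S) z =
      sorted_gf R (Suc k) S z + (\<Sum>as\<in>(#) x ` sorted_lists R k S'. z ^ sum_list as)"
    unfolding sorted_gf_def assms(4)
    by (intro sum.union_disjoint finite_sorted_lists finite_imageI assms fin)
  also have "(\<Sum>as\<in>(#) x ` sorted_lists R k S'. z ^ sum_list as) = z ^ x * sorted_gf R k S' z"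
    unfolding sorted_gf_def
    by (subst sum.reindex) (auto simp: power_add sum_distrib_left)
  finally show ?thesis .
qed

text \<open>As \<open>x\<close> lies below all of \<open>S\<close>, a sorted list that contains
  \<open>x\<close> starts with it. The weak order lets \<open>x\<close> recur, so the tail again
  ranges over \<open>insert x S\<close>.\<close>

lemma sorted_gf_insert_le:
  assumes "finite S" "\<forall>y\<in>S. x < y"
  shows "sorted_gf (\<le>) (Suc k) (insert x S) z =
           sorted_gf (\<le>) (Suc k) S z + z ^ x * sorted_gf (\<le>) k (insert x S) z"
proof (rule sorted_gf_insert_aux)
  show "sorted_lists (\<le>) (Suc k) (insert x S) =
      sorted_lists (\<le>) (Suc k) S \<union> (#) x ` sorted_lists (\<le>) k (insert x S)" (is "?L = ?A \<union> ?B")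
  proof (intro equalityI subsetI)
    fix as assume as: "as \<in> ?L"
    then obtain y ys where ys: "as = y # ys" by (cases as) (auto simp: sorted_lists_def)
    show "as \<in> ?A \<union> ?B"
    proof (cases "y = x")
      case True
      thus ?thesis using as ys by (auto simp: sorted_lists_def)
    next
      case False
      hence "y \<in> S" using as ys by (auto simp: sorted_lists_def)
      hence "x < y" using assms by blast
      hence "x \<notin> set ys" using as ys by (auto simp: sorted_lists_def)
      thus ?thesis using as ys \<open>y \<in> S\<close> by (auto simp: sorted_lists_def)
    qed
  next
    fix as assume "as \<in> ?A \<union> ?B"
    moreover have "x \<le> y" if "set ys \<subseteq> insert x S" "y \<in> set ys" for y ys
      using that assms by force
    ultimately show "as \<in> ?L" by (auto simp: sorted_lists_def)
  qed
qed (use assms in auto)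

text \<open>Strictness forbids a second \<open>x\<close>, so here the tail is drawn from
  \<open>S\<close> alone.\<close>

lemma sorted_gf_insert_less:
  assumes "finite S" "\<forall>y\<in>S. x < y"
  shows "sorted_gf (<) (Suc k) (insert x S) z =
           sorted_gf (<) (Suc k) S z + z ^ x * sorted_gf (<) k S z"
proof (rule sorted_gf_insert_aux)
  show "sorted_lists (<) (Suc k) (insert x S) =
      sorted_lists (<) (Suc k) S \<union> (#) x ` sorted_lists (<) k S" (is "?L = ?A \<union> ?B")
  proof (intro equalityI subsetI)
    fix as assume as: "as \<in> ?L"
    then obtain y ys where ys: "as = y # ys" by (cases as) (auto simp: sorted_lists_def)
    show "as \<in> ?A \<union> ?B"
    proof (cases "y = x")
      case True
      thus ?thesis using as ys by (auto simp: sorted_lists_def)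
    next
      case False
      hence "y \<in> S" using as ys by (auto simp: sorted_lists_def)
      hence "x < y" using assms by blast
      hence "x \<notin> set ys" using as ys by (auto simp: sorted_lists_def)
      thus ?thesis using as ys \<open>y \<in> S\<close> by (auto simp: sorted_lists_def)
    qed
  next
    fix as assume "as \<in> ?A \<union> ?B"
    moreover have "x < y" if "set ys \<subseteq> S" "y \<in> set ys" for y ys
      using that assms by force
    ultimately show "as \<in> ?L" by (auto simp: sorted_lists_def)
  qed
qed (use assms in auto)

text \<open>Induction on \<open>S\<close> by adding a new minimum \<open>x\<close>, which fits the
  recursion for sorted lists; the power sums then gain one power of \<open>w = z ^ x\<close>. For
  finite sets no question of convergence arises.\<close>

lemma newton_le_finite:
  assumes "finite S"
  shows "of_nat (Suc k) * sorted_gf (\<le>) (Suc k) S z =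
           (\<Sum>i\<le>k. sorted_gf (\<le>) (k - i) S z * (\<Sum>a\<in>S. (z ^ Suc i) ^ a))"
  using assms
proof (induction S arbitrary: k rule: finite_linorder_min_induct)
  case empty
  show ?case by simp
next
  case (insert x S)
  define w where "w = z ^ x"
  define h where "h = (\<lambda>k. sorted_gf (\<le>) k S z)"
  define h' where "h' = (\<lambda>k. sorted_gf (\<le>) k (insert x S) z)"
  \<comment> \<open>The index is shifted: \<open>p i\<close> is the power sum of degree
    \<open>i + 1\<close>.\<close>
  define p where "p = (\<lambda>i. \<Sum>a\<in>S. (z ^ Suc i) ^ a)"
  define p' where "p' = (\<lambda>i. \<Sum>a\<in>insert x S. (z ^ Suc i) ^ a)"
  have h': "h' (Suc k) = h (Suc k) + w * h' k" for k
    unfolding h'_def h_def w_def using insert by (intro sorted_gf_insert_le) auto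
  have h0: "h 0 = 1" "h' 0 = 1" by (simp_all add: h_def h'_def)
  have "x \<notin> S" using insert by auto
  hence p': "p' i = p i + w ^ Suc i" for i
    using insert(1) by (simp add: p'_def p_def w_def flip: power_mult power_Suc) (simp add: mult.commute)
  have IH: "of_nat (Suc k) * h (Suc k) = (\<Sum>i\<le>k. h (k - i) * p i)" for k
    using insert(3)[of k] by (simp add: h_def p_def)
  \<comment> \<open>Here \<open>i\<close> counts the occurrences of \<open>x\<close> in a
    list.\<close>
  have gen: "(\<Sum>i\<le>k. h (k - i) * w ^ i) = h' k" for k
  proof (induction k)
    case 0
    show ?case by (simp add: h0)
  next
    case (Suc k)
    have "(\<Sum>i\<le>Suc k. h (Suc k - i) * w ^ i) = h (Suc k) + w * (\<Sum>i\<le>k. h (k - i) * w ^ i)"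
      by (subst sum.atMost_Suc_shift) (simp add: sum_distrib_left mult_ac)
    thus ?case by (simp add: Suc h')
  qed
  \<comment> \<open>After splitting \<open>h'\<close> by its recursion, the part with factor
    \<open>w\<close> is the identity one degree lower. The rest is Newton's identity for
    \<open>S\<close> together with \<open>gen\<close>.\<close>
  have "of_nat (Suc k) * h' (Suc k) = (\<Sum>i\<le>k. h' (k - i) * p' i)" for k
  proof (induction k)
    case 0
    show ?case using IH[of 0] by (simp add: h' h0 p')
  next
    case (Suc k)
    have "(\<Sum>i\<le>Suc k. h' (Suc k - i) * p' i) = (\<Sum>i\<le>k. h' (Suc (k - i)) * p' i) + p' (Suc k)"
      by (simp add: h0 Suc_diff_le)
    also have "(\<Sum>i\<le>k. h' (Suc (k - i)) * p' i) =
        (\<Sum>i\<le>k. h (Suc (k - i)) * p' i) + w * (\<Sum>i\<le>k. h' (k - i) * p' i)"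
      by (simp add: h' algebra_simps sum.distrib sum_distrib_left)
    also have "(\<Sum>i\<le>k. h' (k - i) * p' i) = of_nat (Suc k) * h' (Suc k)"
      using Suc by simp
    also have "(\<Sum>i\<le>k. h (Suc (k - i)) * p' i) + w * (of_nat (Suc k) * h' (Suc k)) + p' (Suc k) =
        (\<Sum>i\<le>Suc k. h (Suc k - i) * p' i) + w * (of_nat (Suc k) * h' (Suc k))"
      by (simp add: h0 Suc_diff_le)
    also have "(\<Sum>i\<le>Suc k. h (Suc k - i) * p' i) =
        (\<Sum>i\<le>Suc k. h (Suc k - i) * p i) + w * (\<Sum>i\<le>Suc k. h (Suc k - i) * w ^ i)"
      unfolding p' by (simp only: distrib_left sum.distrib sum_distrib_left power_Suc mult_ac)
    also have "\<dots> = of_nat (Suc (Suc k)) * h (Suc (Suc k)) + w * h' (Suc k)"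
      by (simp only: IH gen)
    finally show ?case by (simp add: h'[of "Suc k"] algebra_simps)
  qed
  thus ?case by (simp add: h'_def p'_def)
qed

text \<open>The same induction on \<open>S\<close>. The recursion now ends in \<open>h\<close>
  instead of \<open>h'\<close>, and inverting it produces the alternating signs.\<close>

lemma newton_less_finite:
  assumes "finite S"
  shows "of_nat (Suc k) * sorted_gf (<) (Suc k) S z =
           (\<Sum>i\<le>k. (-1) ^ i * sorted_gf (<) (k - i) S z * (\<Sum>a\<in>S. (z ^ Suc i) ^ a))"
  using assms
proof (induction S arbitrary: k rule: finite_linorder_min_induct)
  case empty
  show ?case by simp
next
  case (insert x S)
  define w where "w = z ^ x"
  define h where "h = (\<lambda>k. sorted_gf (<) k S z)"
  define h' where "h' = (\<lambda>k. sorted_gf (<) k (insert x S) z)"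
  define p where "p = (\<lambda>i. \<Sum>a\<in>S. (z ^ Suc i) ^ a)"
  define p' where "p' = (\<lambda>i. \<Sum>a\<in>insert x S. (z ^ Suc i) ^ a)"
  have h': "h' (Suc k) = h (Suc k) + w * h k" for k
    unfolding h'_def h_def w_def using insert by (intro sorted_gf_insert_less) auto
  have h0: "h 0 = 1" "h' 0 = 1" by (simp_all add: h_def h'_def)
  have "x \<notin> S" using insert by auto
  hence p': "p' i = p i + w ^ Suc i" for i
    using insert(1) by (simp add: p'_def p_def w_def flip: power_mult power_Suc) (simp add: mult.commute)
  have IH: "of_nat (Suc k) * h (Suc k) = (\<Sum>i\<le>k. (-1) ^ i * h (k - i) * p i)" for k
    using insert(3)[of k] by (simp add: h_def p_def)
  \<comment> \<open>The inverse of the recursion \<open>h'\<close>; in terms of generating functions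
    in \<open>t\<close>, a division by \<open>1 + w * t\<close>.\<close>
  have gen: "(\<Sum>i\<le>k. (-1) ^ i * h' (k - i) * w ^ i) = h k" for k
  proof (induction k)
    case 0
    show ?case by (simp add: h0)
  next
    case (Suc k)
    have "(\<Sum>i\<le>Suc k. (-1) ^ i * h' (Suc k - i) * w ^ i) =
        h' (Suc k) - w * (\<Sum>i\<le>k. (-1) ^ i * h' (k - i) * w ^ i)"
      by (subst sum.atMost_Suc_shift) (simp add: sum_distrib_left mult_ac sum_negf)
    thus ?case by (simp add: Suc h')
  qed
  \<comment> \<open>Splitting \<open>h'\<close> leads to the identity for \<open>S\<close> in the
    two degrees \<open>k + 1\<close> and \<open>k\<close>; the second is void for
    \<open>k = 0\<close>, hence the case distinction.\<close>
  have P: "(\<Sum>i\<le>k. (-1) ^ i * h' (k - i) * p i) = of_nat (Suc k) * h (Suc k) + w * (of_nat k * h k)" for k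
  proof (cases k)
    case 0
    thus ?thesis using IH[of 0] by (simp add: h0)
  next
    case (Suc m)
    have "(\<Sum>i\<le>Suc m. (-1) ^ i * h' (Suc m - i) * p i) =
        (\<Sum>i\<le>m. (-1) ^ i * h' (Suc (m - i)) * p i) + (-1) ^ Suc m * p (Suc m)"
      by (simp add: h0 Suc_diff_le)
    also have "(\<Sum>i\<le>m. (-1) ^ i * h' (Suc (m - i)) * p i) =
        (\<Sum>i\<le>m. (-1) ^ i * h (Suc (m - i)) * p i) + w * (\<Sum>i\<le>m. (-1) ^ i * h (m - i) * p i)"
      by (simp add: h' algebra_simps sum.distrib sum_distrib_left)
    also have "\<dots> + (-1) ^ Suc m * p (Suc m) =
        (\<Sum>i\<le>Suc m. (-1) ^ i * h (Suc m - i) * p i) + w * (\<Sum>i\<le>m. (-1) ^ i * h (m - i) * p i)"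
      by (simp add: h0 Suc_diff_le)
    finally show ?thesis unfolding Suc IH[symmetric] by simp
  qed
  have "(\<Sum>i\<le>k. (-1) ^ i * h' (k - i) * p' i) =
      (\<Sum>i\<le>k. (-1) ^ i * h' (k - i) * p i) + w * (\<Sum>i\<le>k. (-1) ^ i * h' (k - i) * w ^ i)" for k
    unfolding p' by (simp only: distrib_left sum.distrib sum_distrib_left power_Suc mult_ac)
  hence "of_nat (Suc k) * h' (Suc k) = (\<Sum>i\<le>k. (-1) ^ i * h' (k - i) * p' i)"
    unfolding P gen h' by (simp add: algebra_simps)
  thus ?case by (simp add: h'_def p'_def)
qed

text \<open>Here \<open>s\<close> is the sign in Newton's identities. Every term besides
  \<open>p 1 ^ n\<close> contains a power sum of degree at least 2, which spends a single factor
  \<open>P\<close> on two or more degrees; this saves one power of \<open>P\<close>. The saving is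
  written as a factor \<open>P\<close> on the left so that \<open>n = 0\<close> is covered.\<close>

lemma newton_bounds:
  fixes h p :: "nat \<Rightarrow> complex" and s :: complex and P :: real
  assumes s: "norm s = 1" and h0: "h 0 = 1"
    and newton: "\<And>n. of_nat (Suc n) * h (Suc n) = (\<Sum>i\<le>n. s ^ i * h (n - i) * p (Suc i))"
    and P: "P \<ge> 1" "\<And>i. i \<in> {1..k} \<Longrightarrow> norm (p i) \<le> P"
  shows "n \<le> k \<Longrightarrow> norm (h n) \<le> P ^ n"
    and "n \<le> k \<Longrightarrow> P * norm (fact n * h n - p 1 ^ n) \<le> fact n * P ^ n"
proof -
  show bound: "norm (h n) \<le> P ^ n" if "n \<le> k" for n
    using that
  proof (induction n rule: less_induct)
    case (less n)
    show ?case
    proof (cases n)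
      case 0
      thus ?thesis by (simp add: h0)
    next
      case (Suc m)
      have "real (Suc m) * norm (h (Suc m)) = norm (of_nat (Suc m) * h (Suc m))"
        by (simp only: norm_mult norm_of_nat)
      also have "\<dots> \<le> (\<Sum>i\<le>m. norm (s ^ i * h (m - i) * p (Suc i)))"
        unfolding newton by (rule norm_sum)
      also have "\<dots> \<le> (\<Sum>i\<le>m. P ^ Suc m)"
      proof (rule sum_mono)
        fix i assume i: "i \<in> {..m}"
        have "norm (h (m - i)) * norm (p (Suc i)) \<le> P ^ (m - i) * P"
          using less Suc P i by (intro mult_mono) auto
        also have "\<dots> = P ^ Suc (m - i)" by simp
        also have "\<dots> \<le> P ^ Suc m" using P by (intro power_increasing) auto
        finally show "norm (s ^ i * h (m - i) * p (Suc i)) \<le> P ^ Suc m"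
          by (simp add: norm_mult norm_power s)
      qed
      also have "\<dots> = real (Suc m) * P ^ Suc m" by simp
      finally show ?thesis unfolding Suc by (simp only: mult_le_cancel_left_pos of_nat_0_less_iff zero_less_Suc)
    qed
  qed
  show "P * norm (fact n * h n - p 1 ^ n) \<le> fact n * P ^ n" if "n \<le> k"
    using that
  proof (induction n)
    case 0
    show ?case using P by (simp add: h0)
  next
    case (Suc n)
    \<comment> \<open>\<open>Q\<close> holds the terms with power sums of degree at least 2; each of
      them is at most \<open>P ^ Suc (n - i)\<close>, hence at most \<open>P ^ n\<close>.\<close>
    define Q where "Q = (\<Sum>i\<in>{1..n}. s ^ i * h (n - i) * p (Suc i))"
    have "of_nat (Suc n) * h (Suc n) = h n * p 1 + Q"
      unfolding newton Q_def atMost_atLeast0 by (subst sum.atLeast_Suc_atMost) auto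
    moreover have "fact (Suc n) * h (Suc n) = fact n * (of_nat (Suc n) * h (Suc n))"
      by (simp add: algebra_simps)
    ultimately have "fact (Suc n) * h (Suc n) = fact n * (h n * p 1 + Q)"
      by metis
    hence eq: "fact (Suc n) * h (Suc n) - p 1 ^ Suc n = p 1 * (fact n * h n - p 1 ^ n) + fact n * Q"
      by (simp add: algebra_simps)
    have "norm Q \<le> (\<Sum>i\<in>{1..n}. P ^ n)"
      unfolding Q_def
    proof (rule sum_norm_le)
      fix i assume i: "i \<in> {1..n}"
      have "norm (h (n - i)) * norm (p (Suc i)) \<le> P ^ (n - i) * P"
        using bound[of "n - i"] Suc.prems P i by (intro mult_mono) auto
      also have "\<dots> = P ^ Suc (n - i)" by simp
      also have "\<dots> \<le> P ^ n" using P i by (intro power_increasing) auto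
      finally show "norm (s ^ i * h (n - i) * p (Suc i)) \<le> P ^ n"
        by (simp add: norm_mult norm_power s)
    qed
    hence "P * norm Q \<le> P * (real n * P ^ n)" using P by (intro mult_left_mono) auto
    hence Q: "P * norm Q \<le> real n * P ^ Suc n" by (simp add: mult_ac)
    have "P * norm (fact (Suc n) * h (Suc n) - p 1 ^ Suc n) \<le>
        P * (norm (p 1) * norm (fact n * h n - p 1 ^ n) + fact n * norm Q)"
      unfolding eq using P by (intro mult_left_mono order.trans[OF norm_triangle_ineq]) (auto simp: norm_mult)
    also have "\<dots> = norm (p 1) * (P * norm (fact n * h n - p 1 ^ n)) + fact n * (P * norm Q)"
      by (simp add: algebra_simps)
    also have "\<dots> \<le> P * (fact n * P ^ n) + fact n * (real n * P ^ Suc n)"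
    proof (intro add_mono)
      show "norm (p 1) * (P * norm (fact n * h n - p 1 ^ n)) \<le> P * (fact n * P ^ n)"
        by (rule mult_mono) (use Suc P in auto)
      show "fact n * (P * norm Q) \<le> fact n * (real n * P ^ Suc n)"
        by (intro mult_left_mono Q) auto
    qed
    \<comment> \<open>The identity \<open>fact n + n * fact n = fact (Suc n)\<close> is what makes
      \<open>fact n\<close> the right constant.\<close>
    also have "\<dots> = fact (Suc n) * P ^ Suc n"
      by (simp add: algebra_simps)
    finally show ?case .
  qed
qed

subsection \<open>Parseval's identity on circles\<close>

text \<open>Absolute convergence at the radius \<open>r\<close> itself gives uniform convergence on
  the closed disc, so that means can be taken over its boundary circle.\<close>

definition has_power_series :: "real \<Rightarrow> (nat \<Rightarrow> complex) \<Rightarrow> (complex \<Rightarrow> complex) \<Rightarrow> bool" where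
  "has_power_series r b F \<longleftrightarrow> summable (\<lambda>n. norm (b n) * r ^ n) \<and>
     (\<forall>z. norm z \<le> r \<longrightarrow> (\<lambda>n. b n * z ^ n) sums F z)"

definition circle_mean :: "real \<Rightarrow> (complex \<Rightarrow> real) \<Rightarrow> real" where
  "circle_mean r \<phi> = integral {0..2 * pi} (\<lambda>t. \<phi> (of_real r * cis t)) / (2 * pi)"

section \<open>Closure properties of power series on a closed disc\<close>

lemma summable_power_series_bound:
  fixes b :: "nat \<Rightarrow> complex"
  assumes "summable (\<lambda>n. norm (b n) * r ^ n)" "norm z \<le> r"
  shows "summable (\<lambda>n. norm (b n * z ^ n))"
proof (rule summable_comparison_test'[OF assms(1)])
  fix n :: nat
  show "norm (norm (b n * z ^ n)) \<le> norm (b n) * r ^ n"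
    using assms(2) by (auto simp: norm_mult norm_power intro!: mult_left_mono power_mono)
qed

lemma has_power_series_suminf:
  assumes "summable (\<lambda>n. norm (b n) * r ^ n)"
  shows "has_power_series r b (\<lambda>z. \<Sum>n. b n * z ^ n)"
  unfolding has_power_series_def
  using assms summable_norm_cancel[OF summable_power_series_bound[OF assms]]
  by (auto intro: summable_sums)

lemma has_power_series_diff:
  assumes "has_power_series r b F" "has_power_series r d G" "r \<ge> 0"
  shows "has_power_series r (\<lambda>n. b n - d n) (\<lambda>z. F z - G z)"
  unfolding has_power_series_def
proof (intro conjI allI impI)
  have "summable (\<lambda>n. norm (b n) * r ^ n + norm (d n) * r ^ n)"
    using assms by (intro summable_add) (auto simp: has_power_series_def)
  thus "summable (\<lambda>n. norm (b n - d n) * r ^ n)"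
  proof (rule summable_comparison_test')
    fix n
    show "norm (norm (b n - d n) * r ^ n) \<le> norm (b n) * r ^ n + norm (d n) * r ^ n"
      using mult_right_mono[OF norm_triangle_ineq4[of "b n" "d n"], of "r ^ n"] assms(3)
      by (simp add: distrib_right)
  qed
  fix z :: complex assume "norm z \<le> r"
  thus "(\<lambda>n. (b n - d n) * z ^ n) sums (F z - G z)"
    using assms sums_diff[of "\<lambda>n. b n * z ^ n" "F z" "\<lambda>n. d n * z ^ n" "G z"]
    by (auto simp: has_power_series_def left_diff_distrib)
qed

lemma has_power_series_cmult:
  assumes "has_power_series r b F"
  shows "has_power_series r (\<lambda>n. C * b n) (\<lambda>z. C * F z)"
  using assms summable_mult[of "\<lambda>n. norm (b n) * r ^ n" "norm C"]
  by (auto simp: has_power_series_def norm_mult mult.assoc intro!: sums_mult)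

lemma has_power_series_mult:
  assumes "has_power_series r b F" "has_power_series r d G" "r \<ge> 0"
  shows "has_power_series r (\<lambda>n. \<Sum>i\<le>n. b i * d (n - i)) (\<lambda>z. F z * G z)"
  unfolding has_power_series_def
proof (intro conjI allI impI)
  have sb: "summable (\<lambda>n. norm (b n) * r ^ n)" and sd: "summable (\<lambda>n. norm (d n) * r ^ n)"
    using assms by (auto simp: has_power_series_def)
  have "summable (\<lambda>n. \<Sum>i\<le>n. (norm (b i) * r ^ i) * (norm (d (n - i)) * r ^ (n - i)))"
    using sb sd assms(3) by (intro summable_Cauchy_product) (auto simp: abs_mult)
  thus "summable (\<lambda>n. norm (\<Sum>i\<le>n. b i * d (n - i)) * r ^ n)"
  proof (rule summable_comparison_test')
    fix n :: nat
    have "norm (norm (\<Sum>i\<le>n. b i * d (n - i)) * r ^ n) = norm (\<Sum>i\<le>n. b i * d (n - i)) * r ^ n"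
      using assms(3) by simp
    also have "\<dots> \<le> (\<Sum>i\<le>n. norm (b i) * norm (d (n - i))) * r ^ n"
      using assms(3) by (intro mult_right_mono order.trans[OF norm_sum] sum_mono) (auto simp: norm_mult)
    also have "\<dots> = (\<Sum>i\<le>n. (norm (b i) * r ^ i) * (norm (d (n - i)) * r ^ (n - i)))"
      unfolding sum_distrib_right
    proof (intro sum.cong refl)
      fix i assume "i \<in> {..n}"
      hence "r ^ n = r ^ i * r ^ (n - i)" by (simp flip: power_add)
      thus "norm (b i) * norm (d (n - i)) * r ^ n = norm (b i) * r ^ i * (norm (d (n - i)) * r ^ (n - i))"
        by simp
    qed
    finally show "norm (norm (\<Sum>i\<le>n. b i * d (n - i)) * r ^ n) \<le>
        (\<Sum>i\<le>n. (norm (b i) * r ^ i) * (norm (d (n - i)) * r ^ (n - i)))" .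
  qed
  fix z :: complex assume z: "norm z \<le> r"
  have "(\<lambda>n. \<Sum>i\<le>n. (b i * z ^ i) * (d (n - i) * z ^ (n - i))) sums
      ((\<Sum>n. b n * z ^ n) * (\<Sum>n. d n * z ^ n))"
    by (intro Cauchy_product_sums summable_power_series_bound[OF sb z] summable_power_series_bound[OF sd z])
  moreover have "(\<Sum>n. b n * z ^ n) = F z" "(\<Sum>n. d n * z ^ n) = G z"
    using assms z by (auto simp: has_power_series_def sums_iff)
  moreover have "(\<Sum>i\<le>n. (b i * z ^ i) * (d (n - i) * z ^ (n - i))) = (\<Sum>i\<le>n. b i * d (n - i)) * z ^ n" for n
    unfolding sum_distrib_right
  proof (intro sum.cong refl)
    fix i assume "i \<in> {..n}"
    hence "z ^ n = z ^ i * z ^ (n - i)" by (simp flip: power_add)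
    thus "b i * z ^ i * (d (n - i) * z ^ (n - i)) = b i * d (n - i) * z ^ n"
      by simp
  qed
  ultimately show "(\<lambda>n. (\<Sum>i\<le>n. b i * d (n - i)) * z ^ n) sums (F z * G z)" by simp
qed

text \<open>The coefficients stay anonymous: the comparison in \<open>circle_mean_power_le\<close>
  asks nothing about their values.\<close>

lemma has_power_series_power_mult:
  assumes "has_power_series r b F" "has_power_series r d G" "r \<ge> 0"
  shows "\<exists>e. has_power_series r e (\<lambda>z. F z ^ m * G z)"
proof (induction m)
  case 0
  show ?case using assms by auto
next
  case (Suc m)
  then obtain e where "has_power_series r e (\<lambda>z. F z ^ m * G z)" ..
  from has_power_series_mult[OF assms(1) this assms(3)] show ?case
    by (auto simp: mult_ac)
qed

lemma has_power_series_geometric: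
  assumes "0 \<le> q" "q \<le> 1" "0 \<le> r" "r < 1"
  shows "has_power_series r (\<lambda>n. of_real (q ^ n)) (\<lambda>z. 1 / (1 - of_real q * z))"
  unfolding has_power_series_def
proof (intro conjI allI impI)
  have qr: "q * r < 1" using assms by (metis le_less_trans mult_left_le_one_le)
  show "summable (\<lambda>n. norm (complex_of_real (q ^ n)) * r ^ n)"
    using assms qr by (simp add: norm_power flip: power_mult_distrib)
  fix z :: complex assume "norm z \<le> r"
  hence "norm (of_real q * z) \<le> q * r" using assms by (auto simp: norm_mult intro!: mult_left_mono)
  hence "norm (of_real q * z) < 1" using qr by linarith
  from geometric_sums[OF this] show "(\<lambda>n. of_real (q ^ n) * z ^ n) sums (1 / (1 - of_real q * z))"
    by (simp add: power_mult_distrib)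
qed

section \<open>Uniform convergence and continuity\<close>

lemma uniform_limit_power_series:
  assumes "has_power_series r b F"
  shows "uniform_limit (cball 0 r) (\<lambda>n z. \<Sum>i<n. b i * z ^ i) F sequentially"
proof -
  have "uniform_limit (cball 0 r) (\<lambda>n z. \<Sum>i<n. b i * z ^ i) (\<lambda>z. \<Sum>i. b i * z ^ i) sequentially"
  proof (rule Weierstrass_m_test)
    show "summable (\<lambda>n. norm (b n) * r ^ n)" using assms by (simp add: has_power_series_def)
    fix n and z :: complex assume "z \<in> cball 0 r"
    thus "norm (b n * z ^ n) \<le> norm (b n) * r ^ n"
      by (auto simp: norm_mult norm_power intro!: mult_left_mono power_mono)
  qed
  moreover have "(\<Sum>i. b i * z ^ i) = F z" if "z \<in> cball 0 r" for z
    using assms that by (auto simp: has_power_series_def sums_iff)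
  ultimately show ?thesis
    by (subst (asm) uniform_limit_cong'[where g = "\<lambda>n z. \<Sum>i<n. b i * z ^ i" and i = F]) auto
qed

lemma continuous_on_power_series:
  assumes "has_power_series r b F"
  shows "continuous_on (cball 0 r) F"
  by (rule uniform_limit_theorem[OF _ uniform_limit_power_series[OF assms]])
     (auto intro!: always_eventually continuous_intros)

section \<open>Rules for means over circles\<close>

lemma circle_mean_integrable:
  fixes \<phi> :: "complex \<Rightarrow> real"
  assumes "continuous_on (sphere 0 r) \<phi>" "r \<ge> 0"
  shows "(\<lambda>t. \<phi> (of_real r * cis t)) integrable_on {0..2 * pi}"
proof (rule integrable_continuous_interval)
  show "continuous_on {0..2 * pi} (\<lambda>t. \<phi> (of_real r * cis t))"
    using assms
    by (intro continuous_on_compose2[OF assms(1)] continuous_intros) (auto simp: norm_mult)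
qed

lemma circle_mean_mono:
  assumes "continuous_on (sphere 0 r) \<phi>" "continuous_on (sphere 0 r) \<psi>" "r \<ge> 0"
    and "\<And>z. norm z = r \<Longrightarrow> \<phi> z \<le> \<psi> z"
  shows "circle_mean r \<phi> \<le> circle_mean r \<psi>"
  unfolding circle_mean_def
  using assms by (intro divide_right_mono integral_le circle_mean_integrable) (auto simp: norm_mult)

lemma circle_mean_add:
  assumes "continuous_on (sphere 0 r) \<phi>" "continuous_on (sphere 0 r) \<psi>" "r \<ge> 0"
  shows "circle_mean r (\<lambda>z. \<phi> z + \<psi> z) = circle_mean r \<phi> + circle_mean r \<psi>"
  unfolding circle_mean_def
  using assms by (simp add: integral_add circle_mean_integrable add_divide_distrib)

lemma circle_mean_cmult: "circle_mean r (\<lambda>z. C * \<phi> z) = C * circle_mean r \<phi>"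
  by (simp add: circle_mean_def)

lemma circle_mean_sum:
  assumes "finite I" "\<And>i. i \<in> I \<Longrightarrow> continuous_on (sphere 0 r) (\<phi> i)" "r \<ge> 0"
  shows "circle_mean r (\<lambda>z. \<Sum>i\<in>I. \<phi> i z) = (\<Sum>i\<in>I. circle_mean r (\<phi> i))"
  unfolding circle_mean_def
  using assms by (simp add: integral_sum circle_mean_integrable sum_divide_distrib)

section \<open>Orthogonality and Parseval's identity\<close>

lemma has_integral_cis_multiple:
  fixes d :: int
  assumes "d \<noteq> 0"
  shows "((\<lambda>t. cis (of_int d * t)) has_integral 0) {0..2 * pi}"
proof -
  have "((\<lambda>t. cis (of_int d * t)) has_integral
      (cis (of_int d * (2 * pi)) / (\<i> * of_int d) - cis (of_int d * 0) / (\<i> * of_int d))) {0..2 * pi}"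
  proof (rule fundamental_theorem_of_calculus)
    fix t :: real
    have "((\<lambda>t. cis (of_int d * t)) has_vector_derivative (of_int d *\<^sub>R (\<i> * cis (of_int d * t)))) (at t within {0..2 * pi})"
      unfolding has_vector_derivative_def
      by (auto intro!: derivative_eq_intros simp: scaleR_conv_of_real)
    hence "((\<lambda>t. cis (of_int d * t)) has_vector_derivative (of_int d * (\<i> * cis (of_int d * t)))) (at t within {0..2 * pi})"
      by (simp add: scaleR_conv_of_real)
    thus "((\<lambda>t. cis (of_int d * t) / (\<i> * of_int d)) has_vector_derivative cis (of_int d * t))
        (at t within {0..2 * pi})"
      by (auto intro!: derivative_eq_intros simp: assms)
  qed auto
  moreover have "cis (of_int d * (2 * pi)) = 1"
    using cis_multiple_2pi[of "of_int d"] by (simp add: mult_ac)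
  ultimately show ?thesis by simp
qed

text \<open>Adding the term of index \<open>n\<close> creates a cross term with frequencies
  \<open>j * (i - n)\<close> for \<open>i < n\<close>. These are nonzero because
  \<open>j \<ge> 1\<close>, so its mean vanishes. The argument \<open>z ^ j\<close> is carried along
  for the later comparison of \<open>f(z^j)\<close> with \<open>f(z)\<close>.\<close>

lemma circle_mean_partial_sum:
  fixes b :: "nat \<Rightarrow> complex"
  assumes "j \<ge> 1" "r \<ge> 0"
  shows "circle_mean r (\<lambda>z. (norm (\<Sum>i<n. b i * (z ^ j) ^ i))\<^sup>2) = (\<Sum>i<n. (norm (b i))\<^sup>2 * r ^ (2 * j * i))"
proof (induction n)
  case 0
  show ?case by (simp add: circle_mean_def)
next
  case (Suc n)
  define S where "S = (\<lambda>z::complex. \<Sum>i<n. b i * (z ^ j) ^ i)"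
  define u where "u = (\<lambda>z::complex. b n * (z ^ j) ^ n)"
  have cont: "continuous_on X S" "continuous_on X u" for X
    unfolding S_def u_def by (intro continuous_intros)+
  have sq: "(norm (S z + u z))\<^sup>2 = ((norm (S z))\<^sup>2 + (norm (u z))\<^sup>2) + 2 * Re (S z * cnj (u z))" for z
    unfolding cmod_power2 by (simp add: power2_eq_square algebra_simps)
  have "((\<lambda>t. S (of_real r * cis t) * cnj (u (of_real r * cis t))) has_integral 0) {0..2 * pi}"
  proof -
    have "((\<lambda>t. \<Sum>i<n. b i * cnj (b n) * of_real (r ^ (j * i) * r ^ (j * n)) *
        cis (of_int (int j * (int i - int n)) * t)) has_integral (\<Sum>i<n. b i * cnj (b n) * of_real (r ^ (j * i) * r ^ (j * n)) * 0)) {0..2 * pi}"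
      using assms by (intro has_integral_sum has_integral_mult_right has_integral_cis_multiple) auto
    moreover have "(\<Sum>i<n. b i * cnj (b n) * of_real (r ^ (j * i) * r ^ (j * n)) *
        cis (of_int (int j * (int i - int n)) * t)) = S (of_real r * cis t) * cnj (u (of_real r * cis t))" for t
      unfolding S_def u_def sum_distrib_right
    proof (intro sum.cong refl)
      fix i assume "i \<in> {..<n}"
      have "cis (of_int (int j * (int i - int n)) * t) = cis t ^ (j * i) * cnj (cis t ^ (j * n))"
        unfolding complex_cnj_power cis_cnj Complex.DeMoivre cis_mult by (simp add: algebra_simps)
      thus "b i * cnj (b n) * of_real (r ^ (j * i) * r ^ (j * n)) * cis (of_int (int j * (int i - int n)) * t) =
          b i * ((of_real r * cis t) ^ j) ^ i * cnj (b n * ((of_real r * cis t) ^ j) ^ n)"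
        by (simp add: power_mult_distrib mult_ac flip: power_mult)
    qed
    ultimately show ?thesis by simp
  qed
  hence "((\<lambda>t. Re (S (of_real r * cis t) * cnj (u (of_real r * cis t)))) has_integral Re 0) {0..2 * pi}"
    by (rule has_integral_linear[OF _ bounded_linear_Re, unfolded o_def])
  hence cross: "circle_mean r (\<lambda>z. Re (S z * cnj (u z))) = 0"
    by (simp add: circle_mean_def integral_unique)
  have "circle_mean r (\<lambda>z. (norm (u z))\<^sup>2) = (norm (b n))\<^sup>2 * r ^ (2 * j * n)"
    using assms by (simp add: circle_mean_def u_def norm_mult norm_power power_mult_distrib mult_ac flip: power_mult)
  moreover have "circle_mean r (\<lambda>z. (norm (\<Sum>i<Suc n. b i * (z ^ j) ^ i))\<^sup>2) =
      circle_mean r (\<lambda>z. ((norm (S z))\<^sup>2 + (norm (u z))\<^sup>2) + 2 * Re (S z * cnj (u z)))"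
    unfolding sq[symmetric] by (simp add: S_def u_def)
  moreover have "\<dots> = circle_mean r (\<lambda>z. (norm (S z))\<^sup>2 + (norm (u z))\<^sup>2) +
      circle_mean r (\<lambda>z. 2 * Re (S z * cnj (u z)))"
    by (intro circle_mean_add continuous_intros cont assms)
  moreover have "circle_mean r (\<lambda>z. (norm (S z))\<^sup>2 + (norm (u z))\<^sup>2) =
      circle_mean r (\<lambda>z. (norm (S z))\<^sup>2) + circle_mean r (\<lambda>z. (norm (u z))\<^sup>2)"
    by (intro circle_mean_add continuous_intros cont assms)
  ultimately show ?case using Suc cross by (simp only: circle_mean_cmult) (simp add: S_def)
qed

text \<open>The finite identity passes to the limit: as \<open>j \<ge> 1\<close> and
  \<open>r \<le> 1\<close>, the points \<open>z ^ j\<close> stay in the closed disc of radius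
  \<open>r\<close>, where the partial sums converge uniformly.\<close>

lemma parseval:
  assumes F: "has_power_series r b F" and "j \<ge> 1" "0 \<le> r" "r \<le> 1"
  shows "(\<lambda>n. (norm (b n))\<^sup>2 * r ^ (2 * j * n)) sums circle_mean r (\<lambda>z. (norm (F (z ^ j)))\<^sup>2)"
proof -
  define S where "S = (\<lambda>n z. \<Sum>i<n. b i * z ^ i)"
  have in_cball: "(of_real r * cis t) ^ j \<in> cball 0 r" for t
    using assms power_decreasing[of 1 j r] by (simp add: norm_power norm_mult)
  have cont: "continuous_on X (S n)" for n X
    unfolding S_def by (intro continuous_intros)
  have "uniform_limit (cball 0 r) (\<lambda>n z. (norm (S n z))\<^sup>2) (\<lambda>z. (norm (F z))\<^sup>2) sequentially"
  proof -
    have "uniform_limit (cball 0 r) (\<lambda>n z. norm (S n z)) (\<lambda>z. norm (F z)) sequentially"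
      unfolding S_def
      by (rule uniform_limit_compose_uniformly_continuous_on[of _ _ _ _ UNIV norm, OF uniform_limit_power_series[OF F]])
         (auto intro: uniformly_continuous_on_norm uniformly_continuous_on_id)
    moreover have "bounded ((\<lambda>z. norm (F z)) ` cball 0 r)"
      by (intro compact_imp_bounded compact_continuous_image continuous_intros
          continuous_on_power_series[OF F] compact_cball)
    ultimately show ?thesis
      unfolding power2_eq_square
      by (intro bounded_bilinear.bounded_uniform_limit[OF bounded_bilinear_mult])
  qed
  hence ul: "uniform_limit {0..2 * pi} (\<lambda>n t. (norm (S n ((of_real r * cis t) ^ j)))\<^sup>2)
      (\<lambda>t. (norm (F ((of_real r * cis t) ^ j)))\<^sup>2) sequentially"
    by (rule uniform_limit_compose') (use in_cball in auto)
  obtain I J where I: "\<And>n. ((\<lambda>t. (norm (S n ((of_real r * cis t) ^ j)))\<^sup>2) has_integral I n) {0..2 * pi}"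
    and J: "((\<lambda>t. (norm (F ((of_real r * cis t) ^ j)))\<^sup>2) has_integral J) {0..2 * pi}"
    and lim: "(I \<longlongrightarrow> J) sequentially"
    by (rule uniform_limit_integral[OF ul]) (auto intro!: continuous_intros continuous_on_compose2[OF cont[of UNIV]])
  have "I n / (2 * pi) = (\<Sum>i<n. (norm (b i))\<^sup>2 * r ^ (2 * j * i))" for n
    using circle_mean_partial_sum[of j r b n] assms integral_unique[OF I[of n]]
    by (simp add: circle_mean_def S_def)
  moreover have "(\<lambda>n. I n / (2 * pi)) \<longlonglongrightarrow> J / (2 * pi)"
    by (intro tendsto_intros lim) auto
  ultimately show ?thesis
    using integral_unique[OF J] by (simp add: sums_def circle_mean_def)
qed

text \<open>By Parseval both sides sum the same squares, with weights \<open>r ^ (2 * j * n)\<close>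
  and \<open>r ^ (2 * n)\<close>.\<close>

lemma circle_mean_power_le:
  assumes F: "has_power_series r b F" and "j \<ge> 1" "0 \<le> r" "r \<le> 1"
  shows "circle_mean r (\<lambda>z. (norm (F (z ^ j)))\<^sup>2) \<le> circle_mean r (\<lambda>z. (norm (F z))\<^sup>2)"
proof (rule sums_le)
  show "(\<lambda>n. (norm (b n))\<^sup>2 * r ^ (2 * j * n)) sums circle_mean r (\<lambda>z. (norm (F (z ^ j)))\<^sup>2)"
    by (rule parseval[OF assms])
  show "(\<lambda>n. (norm (b n))\<^sup>2 * r ^ (2 * 1 * n)) sums circle_mean r (\<lambda>z. (norm (F z))\<^sup>2)"
    using parseval[OF F, of 1] assms by simp
  show "(norm (b n))\<^sup>2 * r ^ (2 * j * n) \<le> (norm (b n))\<^sup>2 * r ^ (2 * 1 * n)" for n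
    using assms by (intro mult_left_mono power_decreasing mult_right_mono mult_left_mono) auto
qed

text \<open>The mean is computed as the squared norm of the coefficients of \<open>(1 - z) powr (-1/2)\<close>,
  whose Cauchy square is the geometric series by Vandermonde's identity.\<close>

lemma circle_mean_inverse_one_minus:
  assumes "0 < r" "r < 1"
  shows "circle_mean r (\<lambda>z. 1 / norm (1 - z)) \<le> - ln (1 - r\<^sup>2) / r\<^sup>2"
proof -
  \<comment> \<open>\<open>b n\<close> is the central binomial coefficient of order
    \<open>2 * n\<close> divided by \<open>4 ^ n\<close>.\<close>
  define b where "b = (\<lambda>n. (-1) ^ n * ((-1/2 :: real) gchoose n))"
  define F where "F = (\<lambda>z. \<Sum>n. complex_of_real (b n) * z ^ n)"
  have rec: "(real n + 1) * b (Suc n) = (real n + 1/2) * b n" for n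
  proof -
    have "(real n + 1) * ((-1/2 :: real) gchoose Suc n) = - ((real n + 1/2) * ((-1/2) gchoose n))"
      using gbinomial_mult_1[of "-1/2 :: real" n] by (simp add: algebra_simps)
    moreover have "(real n + 1) * b (Suc n) = (-1) ^ Suc n * ((real n + 1) * ((-1/2) gchoose Suc n))"
      by (simp add: b_def)
    ultimately show ?thesis by (simp add: b_def)
  qed
  \<comment> \<open>With \<open>x = n + 1\<close> and denominators cleared, the induction step is
    \<open>(x + 1) * (x - 1/2)^2 \<le> x^3\<close>.\<close>
  have bound: "(real n + 1) * (b n)\<^sup>2 \<le> 1" for n
  proof (induction n)
    case 0
    show ?case by (simp add: b_def)
  next
    case (Suc n)
    define x where "x = real n + 1"
    have x: "x \<ge> 1" by (simp add: x_def)
    have "x ^ 3 * ((x + 1) * (b (Suc n))\<^sup>2) = x * (x + 1) * (x * b (Suc n))\<^sup>2"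
      by (simp add: power2_eq_square power3_eq_cube)
    also have "x * b (Suc n) = (x - 1/2) * b n" using rec[of n] by (simp add: x_def)
    also have "x * (x + 1) * ((x - 1/2) * b n)\<^sup>2 = (x + 1) * (x - 1/2)\<^sup>2 * (x * (b n)\<^sup>2)"
      by (simp add: power_mult_distrib mult_ac)
    also have "\<dots> \<le> (x + 1) * (x - 1/2)\<^sup>2 * 1"
      using Suc x by (intro mult_left_mono) (auto simp: x_def)
    also have "(x + 1) * (x - 1/2)\<^sup>2 = x ^ 3 - (3 * x - 1) / 4"
      by (simp add: power2_eq_square power3_eq_cube field_simps)
    also have "\<dots> * 1 \<le> x ^ 3 * 1" using x by simp
    finally have "(x + 1) * (b (Suc n))\<^sup>2 \<le> 1" using x by (simp add: mult_le_cancel_left_pos)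
    thus ?case by (simp add: x_def)
  qed
  have b1: "\<bar>b n\<bar> \<le> 1" for n
  proof -
    have "(b n)\<^sup>2 \<le> (real n + 1) * (b n)\<^sup>2" by (simp add: distrib_right)
    hence "(b n)\<^sup>2 \<le> 1" using bound[of n] by linarith
    thus ?thesis by (simp add: abs_square_le_1)
  qed
  have "summable (\<lambda>n. norm (complex_of_real (b n)) * r ^ n)"
  proof (rule summable_comparison_test'[OF summable_geometric[of r]])
    show "norm (norm (complex_of_real (b n)) * r ^ n) \<le> r ^ n" for n
      using b1[of n] assms by (simp add: abs_mult mult_left_le_one_le)
  qed (use assms in auto)
  hence F: "has_power_series r (\<lambda>n. complex_of_real (b n)) F"
    unfolding F_def by (rule has_power_series_suminf)
  have conv: "(\<Sum>i\<le>n. complex_of_real (b i) * complex_of_real (b (n - i))) = 1" for n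
  proof -
    have "(\<Sum>i\<le>n. b i * b (n - i)) = (-1) ^ n * (\<Sum>i=0..n. ((-1/2 :: real) gchoose i) * ((-1/2) gchoose (n - i)))"
      unfolding sum_distrib_left atMost_atLeast0
    proof (intro sum.cong refl)
      fix i assume "i \<in> {0..n}"
      hence "(-1 :: real) ^ n = (-1) ^ i * (-1) ^ (n - i)" by (simp flip: power_add)
      thus "b i * b (n - i) = (-1) ^ n * (((-1/2 :: real) gchoose i) * ((-1/2) gchoose (n - i)))"
        by (simp add: b_def)
    qed
    also have "\<dots> = (-1) ^ n * ((-1 :: real) gchoose n)"
      by (subst gbinomial_Vandermonde) simp
    also have "\<dots> = 1"
      using gbinomial_minus[of "1 :: real" n] by (simp flip: power_add binomial_gbinomial add: mult.assoc[symmetric])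
    finally show ?thesis by (metis (no_types, lifting) of_real_1 of_real_mult of_real_sum sum.cong)
  qed
  have sq: "(norm (F z))\<^sup>2 = 1 / norm (1 - z)" if "norm z = r" for z
  proof -
    have "has_power_series r (\<lambda>n. 1) (\<lambda>z. F z * F z)"
      using has_power_series_mult[OF F F] assms by (simp add: conv)
    moreover have "has_power_series r (\<lambda>n. 1) (\<lambda>z. 1 / (1 - z))"
      using has_power_series_geometric[of 1 r] assms by simp
    ultimately have "F z * F z = 1 / (1 - z)"
      using that by (auto simp: has_power_series_def intro: sums_unique2)
    hence "norm (F z * F z) = norm (1 / (1 - z))" by simp
    thus ?thesis by (simp add: norm_mult norm_divide power2_eq_square)
  qed
  have r2: "0 < r\<^sup>2" "r\<^sup>2 < 1" using assms by (auto simp: abs_square_less_1)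
  have "circle_mean r (\<lambda>z. (norm (F (z ^ 1)))\<^sup>2) = circle_mean r (\<lambda>z. 1 / norm (1 - z))"
    using assms by (simp add: circle_mean_def sq norm_mult)
  hence s1: "(\<lambda>n. (norm (complex_of_real (b n)))\<^sup>2 * r ^ (2 * 1 * n)) sums circle_mean r (\<lambda>z. 1 / norm (1 - z))"
    using parseval[OF F, of 1] assms by simp
  \<comment> \<open>The logarithm series, shifted by one index and divided by \<open>- r^2\<close>,
    sums the majorant of the Parseval series that \<open>bound\<close> provides.\<close>
  have "(\<lambda>n. - ((- (- (r\<^sup>2))) ^ n) / of_nat n) sums ln (1 + (- (r\<^sup>2)))"
    by (rule Complex_Transcendental.ln_series') (use r2 in simp)
  hence "(\<lambda>n. - ((r\<^sup>2) ^ Suc n) / of_nat (Suc n)) sums ln (1 - r\<^sup>2)"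
    by (subst sums_Suc_iff) simp
  hence "(\<lambda>n. (- 1 / r\<^sup>2) * (- ((r\<^sup>2) ^ Suc n) / of_nat (Suc n))) sums ((- 1 / r\<^sup>2) * ln (1 - r\<^sup>2))"
    by (rule sums_mult)
  moreover have "(- 1 / r\<^sup>2) * (- ((r\<^sup>2) ^ Suc n) / of_nat (Suc n)) = (r\<^sup>2) ^ n / (real n + 1)" for n
    using r2 by (simp add: field_simps)
  ultimately have s2: "(\<lambda>n. (r\<^sup>2) ^ n / (real n + 1)) sums (- ln (1 - r\<^sup>2) / r\<^sup>2)" by simp
  show ?thesis
  proof (rule sums_le[OF _ s1 s2])
    fix n
    have "(b n)\<^sup>2 \<le> 1 / (real n + 1)" using bound[of n] by (simp add: field_simps)
    hence "(b n)\<^sup>2 * (r\<^sup>2) ^ n \<le> 1 / (real n + 1) * (r\<^sup>2) ^ n"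
      using r2 by (intro mult_right_mono) auto
    thus "(norm (complex_of_real (b n)))\<^sup>2 * r ^ (2 * 1 * n) \<le> (r\<^sup>2) ^ n / (real n + 1)"
      by (simp add: power_mult)
  qed
qed


subsection \<open>Generating functions of infinite sets\<close>

definition set_gf :: "nat set \<Rightarrow> complex \<Rightarrow> complex" where
  "set_gf A z = (\<Sum>n. of_bool (n \<in> A) * z ^ n)"

definition rep_gf :: "(nat \<Rightarrow> nat \<Rightarrow> bool) \<Rightarrow> nat \<Rightarrow> nat set \<Rightarrow> complex \<Rightarrow> complex" where
  "rep_gf R k A z = (\<Sum>n. of_nat (ordered_rep R k A n) * z ^ n)"

section \<open>Convergence inside the unit disc\<close>

lemma summable_nat_power_times_power:
  fixes x :: real
  assumes "\<bar>x\<bar> < 1"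
  shows "summable (\<lambda>n. real n ^ k * x ^ n)"
  using assms
proof (induction k arbitrary: x)
  case 0
  thus ?case by simp
next
  case (Suc k)
  have "summable (\<lambda>n. diffs (\<lambda>n. real n ^ k) n * x ^ n)"
    by (rule termdiff_converges[of x 1]) (use Suc in auto)
  hence "summable (\<lambda>n. x * (diffs (\<lambda>n. real n ^ k) n * x ^ n))"
    by (rule summable_mult)
  hence "summable (\<lambda>n. real (Suc n) ^ Suc k * x ^ Suc n)"
    by (simp add: diffs_def mult_ac)
  thus ?case by (subst (asm) summable_Suc_iff)
qed

text \<open>A polynomial bound independent of \<open>A\<close> gives convergence for every radius
  below 1 and one majorant for all truncations of \<open>A\<close>.\<close>

lemma ordered_rep_le: "ordered_rep R k A n \<le> (n + 1) ^ k"
proof -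
  have "{as. length as = k \<and> set as \<subseteq> A \<and> sorted_wrt R as \<and> sum_list as = n} \<subseteq>
      {as. set as \<subseteq> {..n} \<and> length as = k}"
    using member_le_sum_list by fastforce
  hence "ordered_rep R k A n \<le> card {as. set as \<subseteq> {..n} \<and> length as = k}"
    unfolding ordered_rep_def by (intro card_mono finite_lists_length_eq) auto
  thus ?thesis by (simp add: card_lists_length_eq)
qed

lemma summable_ordered_rep_bound:
  assumes "0 \<le> r" "r < 1"
  shows "summable (\<lambda>n. (real n + 1) ^ k * r ^ n)"
proof (cases "r = 0")
  case True
  have "(\<lambda>n. (real n + 1) ^ k * r ^ n) = (\<lambda>n. if n = 0 then 1 else 0)"
    by (auto simp: True)
  thus ?thesis by simp
next
  case False
  have "summable (\<lambda>n. real (Suc n) ^ k * r ^ Suc n)"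
    using summable_nat_power_times_power[of r k] assms by (subst summable_Suc_iff) auto
  hence "summable (\<lambda>n. 1 / r * (real (Suc n) ^ k * r ^ Suc n))" by (rule summable_mult)
  thus ?thesis using False by (simp add: add.commute)
qed

lemma has_power_series_rep_gf:
  assumes "0 \<le> r" "r < 1"
  shows "has_power_series r (\<lambda>n. of_nat (ordered_rep R k A n)) (rep_gf R k A)"
proof -
  have sm: "summable (\<lambda>n. norm (of_nat (ordered_rep R k A n) :: complex) * r ^ n)"
  proof (rule summable_comparison_test'[OF summable_ordered_rep_bound[OF assms, of k]])
    fix n :: nat
    show "norm (norm (of_nat (ordered_rep R k A n) :: complex) * r ^ n) \<le> (real n + 1) ^ k * r ^ n"
      using ordered_rep_le[of R k A n, folded of_nat_le_iff[where 'a = real]] assms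
      by (auto intro!: mult_right_mono simp: add.commute)
  qed
  show ?thesis
    using has_power_series_suminf[OF sm] by (simp add: rep_gf_def[abs_def])
qed

lemma has_power_series_set_gf:
  assumes "0 \<le> r" "r < 1"
  shows "has_power_series r (\<lambda>n. of_bool (n \<in> A)) (set_gf A)"
proof -
  have sm: "summable (\<lambda>n. norm (of_bool (n \<in> A) :: complex) * r ^ n)"
    by (rule summable_comparison_test'[OF summable_geometric[of r]]) (use assms in auto)
  show ?thesis
    using has_power_series_suminf[OF sm] by (simp add: set_gf_def[abs_def])
qed

section \<open>Passage from finite truncations to infinite sets\<close>

lemma sorted_gf_eq_rep_gf:
  assumes "finite S"
  shows "sorted_gf R k S z = rep_gf R k S z"
proof -
  have fin: "finite (sorted_lists R k S)" by (rule finite_sorted_lists[OF assms])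
  have "(\<lambda>n. \<Sum>as\<in>sorted_lists R k S. if n = sum_list as then z ^ n else 0) sums
      (\<Sum>as\<in>sorted_lists R k S. z ^ sum_list as)"
    by (intro sums_sum sums_single)
  moreover have "(\<Sum>as\<in>sorted_lists R k S. if n = sum_list as then z ^ n else 0) =
      of_nat (ordered_rep R k S n) * z ^ n" for n
  proof -
    have "(\<Sum>as\<in>sorted_lists R k S. if n = sum_list as then z ^ n else 0) =
        (\<Sum>as\<in>{as \<in> sorted_lists R k S. n = sum_list as}. z ^ n)"
      by (rule sum.inter_filter[symmetric, OF fin])
    also have "{as \<in> sorted_lists R k S. n = sum_list as} =
        {as. length as = k \<and> set as \<subseteq> S \<and> sorted_wrt R as \<and> sum_list as = n}"
      by (auto simp: sorted_lists_def)
    finally show ?thesis by (simp add: ordered_rep_def)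
  qed
  ultimately show ?thesis by (simp add: rep_gf_def sorted_gf_def sums_iff)
qed

text \<open>Entries are natural numbers, so a list with sum \<open>j\<close> has no entry above
  \<open>j\<close>.\<close>

lemma ordered_rep_truncate:
  assumes "j \<le> n"
  shows "ordered_rep R k (A \<inter> {..n}) j = ordered_rep R k A j"
proof -
  have "set as \<subseteq> {..n}" if "sum_list as = j" for as
    using that assms member_le_sum_list by fastforce
  hence "{as. length as = k \<and> set as \<subseteq> A \<inter> {..n} \<and> sorted_wrt R as \<and> sum_list as = j} =
      {as. length as = k \<and> set as \<subseteq> A \<and> sorted_wrt R as \<and> sum_list as = j}"
    by blast
  thus ?thesis by (simp add: ordered_rep_def)
qed

text \<open>Dominated convergence for series: each coefficient is eventually constant in the
  truncation, and all are dominated by \<open>(j + 1) ^ k * norm z ^ j\<close>.\<close>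

lemma sorted_gf_tendsto_rep_gf:
  assumes "norm z < 1"
  shows "(\<lambda>n. sorted_gf R k (A \<inter> {..n}) z) \<longlonglongrightarrow> rep_gf R k A z"
proof -
  have "(\<lambda>n. \<Sum>j. of_nat (ordered_rep R k (A \<inter> {..n}) j) * z ^ j) \<longlonglongrightarrow>
      (\<Sum>j. of_nat (ordered_rep R k A j) * z ^ j)"
  proof (rule tannerys_theorem[THEN conjunct2, THEN conjunct2])
    show "(\<lambda>n. of_nat (ordered_rep R k (A \<inter> {..n}) j) * z ^ j) \<longlonglongrightarrow>
        of_nat (ordered_rep R k A j) * z ^ j" for j
      by (rule tendsto_eventually, rule eventually_sequentiallyI[of j]) (simp add: ordered_rep_truncate)
    show "\<forall>\<^sub>F (j, n) in at_top \<times>\<^sub>F sequentially.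
        norm (of_nat (ordered_rep R k (A \<inter> {..n}) j) * z ^ j) \<le> (real j + 1) ^ k * norm z ^ j"
    proof (intro always_eventually allI, clarify)
      fix j n
      show "norm (of_nat (ordered_rep R k (A \<inter> {..n}) j) * z ^ j) \<le> (real j + 1) ^ k * norm z ^ j"
        using ordered_rep_le[of R k "A \<inter> {..n}" j, folded of_nat_le_iff[where 'a = real]]
        by (auto intro!: mult_right_mono simp: add.commute norm_mult norm_power)
    qed
    show "summable (\<lambda>j. (real j + 1) ^ k * norm z ^ j)"
      by (rule summable_ordered_rep_bound) (use assms in auto)
  qed auto
  thus ?thesis by (simp add: sorted_gf_eq_rep_gf rep_gf_def)
qed

lemma power_sum_tendsto_set_gf:
  assumes "norm z < 1"
  shows "(\<lambda>n. \<Sum>a\<in>A \<inter> {..n}. z ^ a) \<longlonglongrightarrow> set_gf A z"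
proof -
  have "(\<lambda>n. of_bool (n \<in> A) * z ^ n) sums set_gf A z"
    using has_power_series_set_gf[of "norm z" A] assms by (simp add: has_power_series_def)
  hence "(\<lambda>n. \<Sum>a\<le>n. of_bool (a \<in> A) * z ^ a) \<longlonglongrightarrow> set_gf A z"
    by (simp add: sums_def_le)
  moreover have "(\<Sum>a\<le>n. of_bool (a \<in> A) * z ^ a) = (\<Sum>a\<in>A \<inter> {..n}. z ^ a)" for n
    by (simp add: of_bool_def if_distrib[of "\<lambda>x. x * _"] Int_commute flip: sum.inter_restrict cong: if_cong)
  ultimately show ?thesis by simp
qed

text \<open>The sign \<open>s\<close> treats both orders at once: it is 1 for \<open>(\<le>)\<close>
  and -1 for \<open>(<)\<close>. The identity holds for every truncation of \<open>A\<close>, and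
  both sides converge.\<close>

lemma newton_infinite:
  assumes R: "R \<in> {(\<le>), (<)}"
  obtains s :: complex where "norm s = 1"
    "\<And>n A z. norm z < 1 \<Longrightarrow> of_nat (Suc n) * rep_gf R (Suc n) A z =
       (\<Sum>i\<le>n. s ^ i * rep_gf R (n - i) A z * set_gf A (z ^ Suc i))"
proof -
  obtain s :: complex where s: "norm s = 1"
    "\<And>n S z. finite S \<Longrightarrow> of_nat (Suc n) * sorted_gf R (Suc n) S z =
       (\<Sum>i\<le>n. s ^ i * sorted_gf R (n - i) S z * (\<Sum>a\<in>S. (z ^ Suc i) ^ a))"
  proof (cases "R = (\<le>)")
    case True
    thus ?thesis by (intro that[of 1]) (use newton_le_finite in auto)
  next
    case False
    hence "R = (<)" using R by blast
    thus ?thesis by (intro that[of "-1"]) (use newton_less_finite in auto)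
  qed
  show ?thesis
  proof (rule that[OF s(1)])
    fix n A and z :: complex assume z: "norm z < 1"
    have zi: "norm (z ^ Suc i) < 1" for i
      using z power_less_one_iff[of "norm z" "Suc i"] by (simp add: norm_mult norm_power)
    have "(\<lambda>m. of_nat (Suc n) * sorted_gf R (Suc n) (A \<inter> {..m}) z) \<longlonglongrightarrow> of_nat (Suc n) * rep_gf R (Suc n) A z"
      by (intro tendsto_intros sorted_gf_tendsto_rep_gf z)
    moreover have "(\<lambda>m. of_nat (Suc n) * sorted_gf R (Suc n) (A \<inter> {..m}) z) \<longlonglongrightarrow>
        (\<Sum>i\<le>n. s ^ i * rep_gf R (n - i) A z * set_gf A (z ^ Suc i))"
      by (subst s(2)) (auto intro!: tendsto_intros sorted_gf_tendsto_rep_gf power_sum_tendsto_set_gf z zi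
            simp del: power_Suc)
    ultimately show "of_nat (Suc n) * rep_gf R (Suc n) A z =
        (\<Sum>i\<le>n. s ^ i * rep_gf R (n - i) A z * set_gf A (z ^ Suc i))"
      by (rule LIMSEQ_unique)
  qed
qed

text \<open>This is \<open>newton_bounds\<close> with \<open>P\<close> the largest of 1 and the
  \<open>norm (set_gf A (z ^ i))\<close>. The maximum is then replaced by a sum, which can be
  averaged over a circle term by term.\<close>

lemma rep_gf_approx:
  assumes R: "R \<in> {(\<le>), (<)}" and z: "norm z < 1" and k: "k \<ge> 1"
  shows "norm (fact k * rep_gf R k A z - set_gf A z ^ k) \<le>
           fact k * (1 + (\<Sum>i=1..k. norm (set_gf A (z ^ i)) ^ (k - 1)))"
proof -
  obtain s :: complex where s: "norm s = 1"
    "\<And>n. of_nat (Suc n) * rep_gf R (Suc n) A z =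
       (\<Sum>i\<le>n. s ^ i * rep_gf R (n - i) A z * set_gf A (z ^ Suc i))"
    using newton_infinite[OF R] z by metis
  define X where "X = insert 1 ((\<lambda>i. norm (set_gf A (z ^ i))) ` {1..k})"
  define P where "P = Max X"
  have X: "finite X" "X \<noteq> {}" by (auto simp: X_def)
  have P: "P \<ge> 1" "\<And>i. i \<in> {1..k} \<Longrightarrow> norm (set_gf A (z ^ i)) \<le> P"
    unfolding P_def by (rule Max_ge[OF X(1)]; force simp: X_def)+
  have h0: "rep_gf R 0 A z = 1"
    by (rule LIMSEQ_unique[OF sorted_gf_tendsto_rep_gf[OF z]]) simp
  have "P * norm (fact k * rep_gf R k A z - set_gf A (z ^ 1) ^ k) \<le> fact k * P ^ k"
    by (rule newton_bounds(2)[where h = "\<lambda>n. rep_gf R n A z" and p = "\<lambda>i. set_gf A (z ^ i)", OF s(1) h0 s(2) P]) auto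
  also have "fact k * P ^ k = P * (fact k * P ^ (k - 1))"
    using k by (cases k) auto
  finally have "norm (fact k * rep_gf R k A z - set_gf A z ^ k) \<le> fact k * P ^ (k - 1)"
    using P(1) by (simp add: mult_le_cancel_left_pos)
  moreover have "P ^ (k - 1) \<le> 1 + (\<Sum>i=1..k. norm (set_gf A (z ^ i)) ^ (k - 1))"
  proof -
    have nn: "(\<Sum>i=1..k. norm (set_gf A (z ^ i)) ^ (k - 1)) \<ge> 0" by (intro sum_nonneg) auto
    have "P \<in> X" unfolding P_def by (rule Max_in[OF X])
    then consider "P = 1" | i where "i \<in> {1..k}" "P = norm (set_gf A (z ^ i))"
      by (auto simp: X_def)
    thus ?thesis
    proof cases
      case 1
      thus ?thesis using nn by simp
    next
      case 2
      have "norm (set_gf A (z ^ i)) ^ (k - 1) \<le> (\<Sum>i=1..k. norm (set_gf A (z ^ i)) ^ (k - 1))"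
        by (rule member_le_sum) (use 2 in auto)
      thus ?thesis using 2 by simp
    qed
  qed
  ultimately show ?thesis
    by (meson fact_ge_zero mult_left_mono order.trans)
qed

subsection \<open>The kernel\<close>

lemma norm_one_minus_scaled_ge:
  fixes z :: complex
  assumes "norm z \<le> 1" "0 \<le> q" "q \<le> 1"
  shows "1 - q \<le> norm (1 - of_real q * z)"
proof -
  have "norm (of_real q * z) \<le> q" using assms by (simp add: norm_mult mult_left_le)
  moreover have "1 - norm (of_real q * z) \<le> norm (1 - of_real q * z)"
    using norm_triangle_ineq2[of 1 "of_real q * z"] by simp
  ultimately show ?thesis by linarith
qed

text \<open>Passing from \<open>1 - z\<close> to \<open>1 - q * z\<close> costs at most
  \<open>1 - q\<close>, which is itself at most \<open>norm (1 - q * z)\<close>.\<close>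

lemma norm_one_minus_le_scaled:
  fixes z :: complex
  assumes "norm z \<le> 1" "0 \<le> q" "q \<le> 1"
  shows "norm (1 - z) \<le> 2 * norm (1 - of_real q * z)"
proof -
  have "1 - z = (1 - of_real q * z) - of_real (1 - q) * z" by (simp add: algebra_simps)
  hence "norm (1 - z) \<le> norm (1 - of_real q * z) + norm (of_real (1 - q) * z)"
    by (metis norm_triangle_ineq4)
  also have "norm (of_real (1 - q) * z) = (1 - q) * norm z"
    using assms by (simp only: norm_mult norm_of_real abs_of_nonneg diff_ge_0_iff_ge)
  also have "\<dots> \<le> 1 - q" using assms by (simp add: mult_left_le)
  also have "\<dots> \<le> norm (1 - of_real q * z)" by (rule norm_one_minus_scaled_ge[OF assms])
  finally show ?thesis by simp
qed

text \<open>Rests on \<open>norm (1 - z ^ i) \<le> i * norm (1 - z)\<close>; the preceding lemma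
  supplies the factor 2, and the summand 1 pays for \<open>1 - q\<close>.\<close>

lemma norm_one_minus_scaled_power_le:
  fixes z :: complex
  assumes "norm z \<le> 1" "0 \<le> q" "q \<le> 1"
  shows "norm (1 - of_real q * z ^ i) \<le> (2 * real i + 1) * norm (1 - of_real q * z)"
proof -
  have "1 - of_real q * z ^ i = of_real (1 - q) + of_real q * (1 - z ^ i)" by (simp add: algebra_simps)
  hence "norm (1 - of_real q * z ^ i) \<le> norm (of_real (1 - q) :: complex) + norm (of_real q * (1 - z ^ i))"
    by (metis norm_triangle_ineq)
  also have "\<dots> = (1 - q) + q * norm (1 - z ^ i)"
    using assms by (simp only: norm_mult norm_of_real abs_of_nonneg diff_ge_0_iff_ge)
  also have "\<dots> \<le> (1 - q) + norm (1 - z ^ i)"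
    using assms by (simp add: mult_left_le_one_le)
  also have "norm (1 - z ^ i) \<le> real i * norm (1 - z)"
    using norm_power_diff[of 1 z i] assms by simp
  also have "\<dots> \<le> real i * (2 * norm (1 - of_real q * z))"
    by (intro mult_left_mono norm_one_minus_le_scaled assms) auto
  finally show ?thesis
    using norm_one_minus_scaled_ge[OF assms] by (simp add: algebra_simps)
qed

text \<open>A weight concentrated near \<open>z = 1\<close>, whose sharpness \<open>1 - q\<close> is
  tuned independently of the radius of the circle.\<close>

definition geom_kernel :: "real \<Rightarrow> complex \<Rightarrow> complex" where
  "geom_kernel q z = 1 / (1 - of_real q * z)"

lemma has_power_series_geom_kernel:
  assumes "0 \<le> q" "q \<le> 1" "0 \<le> r" "r < 1"
  shows "has_power_series r (\<lambda>n. of_real (q ^ n)) (geom_kernel q)"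
  using has_power_series_geometric[OF assms] by (simp add: geom_kernel_def[abs_def])

lemma norm_geom_kernel_le:
  assumes "norm z \<le> 1" "0 \<le> q" "q < 1"
  shows "norm (geom_kernel q z) \<le> 1 / (1 - q)"
  using norm_one_minus_scaled_ge[of z q] assms
  by (auto simp: geom_kernel_def norm_divide intro!: divide_left_mono mult_pos_pos)

text \<open>Moves the kernel to \<open>z ^ i\<close>, so that a power of \<open>f(z^i)\<close> times
  the kernel becomes one power series evaluated at \<open>z ^ i\<close>.\<close>

lemma norm_geom_kernel_le_power:
  assumes "norm z \<le> 1" "0 \<le> q" "q < 1"
  shows "norm (geom_kernel q z) \<le> (2 * real i + 1) * norm (geom_kernel q (z ^ i))"
proof -
  have "norm (z ^ i) \<le> 1" using assms by (simp add: norm_power power_le_one)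
  hence pos: "norm (1 - of_real q * z) > 0" "norm (1 - of_real q * z ^ i) > 0"
    using norm_one_minus_scaled_ge[of z q] norm_one_minus_scaled_ge[of "z ^ i" q] assms
    by linarith+
  show ?thesis
    using norm_one_minus_scaled_power_le[of z q i] assms pos
    by (simp add: geom_kernel_def norm_divide field_simps del: zero_less_norm_iff)
qed

text \<open>One kernel factor cancels the \<open>1 - z\<close> in front of the error series.\<close>

lemma norm_one_minus_times_geom_kernel:
  assumes "norm z \<le> 1" "0 \<le> q" "q < 1"
  shows "norm (1 - z) * norm (geom_kernel q z) \<le> 2"
proof -
  have "norm (1 - of_real q * z) > 0"
    using norm_one_minus_scaled_ge[of z q] assms by linarith
  thus ?thesis
    using norm_one_minus_le_scaled[of z q] assms
    by (simp add: geom_kernel_def norm_divide field_simps del: zero_less_norm_iff)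
qed

lemma circle_mean_geom_kernel:
  assumes "0 \<le> q" "q \<le> 1" "0 \<le> r" "r < 1"
  shows "circle_mean r (\<lambda>z. (norm (geom_kernel q z))\<^sup>2) = 1 / (1 - (q * r)\<^sup>2)"
proof -
  have qr: "(q * r)\<^sup>2 < 1"
    using assms by (metis abs_square_less_1 abs_of_nonneg le_less_trans mult_left_le_one_le mult_nonneg_nonneg)
  have "(\<lambda>n. (norm (complex_of_real (q ^ n)))\<^sup>2 * r ^ (2 * 1 * n)) sums
      circle_mean r (\<lambda>z. (norm (geom_kernel q (z ^ 1)))\<^sup>2)"
    by (rule parseval[OF has_power_series_geom_kernel]) (use assms in auto)
  moreover have "(norm (complex_of_real (q ^ n)))\<^sup>2 * r ^ (2 * 1 * n) = ((q * r)\<^sup>2) ^ n" for n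
  proof -
    have "(norm (complex_of_real (q ^ n)))\<^sup>2 = q ^ (n * 2)"
      using assms by (simp only: norm_of_real) (simp add: power_mult)
    thus ?thesis by (simp only: power_mult_distrib power_mult mult_1_right) (simp add: mult.commute flip: power_mult)
  qed
  ultimately have "(\<lambda>n. ((q * r)\<^sup>2) ^ n) sums circle_mean r (\<lambda>z. (norm (geom_kernel q z))\<^sup>2)" by simp
  moreover have "(\<lambda>n. ((q * r)\<^sup>2) ^ n) sums (1 / (1 - (q * r)\<^sup>2))"
    by (rule geometric_sums) (use qr in simp)
  ultimately show ?thesis by (rule sums_unique2)
qed

section \<open>Values on the real axis and a lower bound in mean square\<close>

definition real_gf :: "nat set \<Rightarrow> real \<Rightarrow> real" where
  "real_gf A x = (\<Sum>n. of_bool (n \<in> A) * x ^ n)"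

lemma summable_real_gf:
  fixes x :: real
  assumes "0 \<le> x" "x < 1"
  shows "summable (\<lambda>n. of_bool (n \<in> A) * x ^ n)"
  by (rule summable_comparison_test'[OF summable_geometric[of x]]) (use assms in auto)

lemma set_gf_of_real:
  assumes "0 \<le> x" "x < 1"
  shows "set_gf A (of_real x) = of_real (real_gf A x)"
proof -
  have "(\<lambda>n. complex_of_real (of_bool (n \<in> A) * x ^ n)) sums of_real (real_gf A x)"
    unfolding real_gf_def by (intro sums_of_real summable_sums summable_real_gf assms)
  moreover have "complex_of_real (of_bool (n \<in> A) * x ^ n) = of_bool (n \<in> A) * of_real x ^ n" for n
    by simp
  ultimately show ?thesis by (simp only: set_gf_def sums_iff)
qed

lemma real_gf_nonneg: "0 \<le> x \<Longrightarrow> x < 1 \<Longrightarrow> real_gf A x \<ge> 0"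
  unfolding real_gf_def by (intro suminf_nonneg summable_real_gf) auto

lemma real_gf_mono: "0 \<le> x \<Longrightarrow> x \<le> y \<Longrightarrow> y < 1 \<Longrightarrow> real_gf A x \<le> real_gf A y"
  unfolding real_gf_def
  by (intro suminf_le summable_real_gf mult_left_mono power_mono) auto

lemma sum_squares_le_square_sum:
  fixes g :: "'a \<Rightarrow> real"
  assumes "finite I" "\<And>i. i \<in> I \<Longrightarrow> g i \<ge> 0"
  shows "(\<Sum>i\<in>I. (g i)\<^sup>2) \<le> (\<Sum>i\<in>I. g i)\<^sup>2"
  using assms
proof (induction I rule: finite_induct)
  case (insert x I)
  have "0 \<le> g x * sum g I" using insert by (intro mult_nonneg_nonneg sum_nonneg) auto
  moreover have "(\<Sum>i\<in>I. (g i)\<^sup>2) \<le> (sum g I)\<^sup>2" using insert by auto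
  ultimately show ?case using insert by (simp add: power2_sum)
qed auto

text \<open>The coefficients of the product are sums of nonnegative terms, so Parseval's sum can
  only shrink when each square of a sum is replaced by the sum of squares. What remains is the
  Cauchy product of the series for \<open>real_gf A (r^2)\<close> with the geometric series in
  \<open>(q * r)^2\<close>.\<close>

lemma circle_mean_set_gf_kernel_ge:
  assumes "0 \<le> q" "q \<le> 1" "0 \<le> r" "r < 1"
  shows "circle_mean r (\<lambda>z. (norm (set_gf A z * geom_kernel q z))\<^sup>2) \<ge> real_gf A (r\<^sup>2) / (1 - (q * r)\<^sup>2)"
proof -
  define b where "b = (\<lambda>n. \<Sum>i\<le>n. of_bool (i \<in> A) * complex_of_real (q ^ (n - i)))"
  have r2: "0 \<le> r\<^sup>2" "r\<^sup>2 < 1" using assms by (auto simp: abs_square_less_1)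
  have qr: "0 \<le> (q * r)\<^sup>2" "(q * r)\<^sup>2 < 1"
    using assms by (auto simp: abs_square_less_1) (metis abs_square_less_1 abs_of_nonneg le_less_trans mult_left_le_one_le mult_nonneg_nonneg)
  have ps: "has_power_series r b (\<lambda>z. set_gf A z * geom_kernel q z)"
    unfolding b_def using assms
    by (intro has_power_series_mult has_power_series_set_gf has_power_series_geom_kernel) auto
  have sums1: "(\<lambda>n. (norm (b n))\<^sup>2 * r ^ (2 * 1 * n)) sums circle_mean r (\<lambda>z. (norm (set_gf A z * geom_kernel q z))\<^sup>2)"
    using parseval[OF ps, of 1] assms by simp
  have "(\<lambda>n. \<Sum>i\<le>n. (of_bool (i \<in> A) * (r\<^sup>2) ^ i) * ((q * r)\<^sup>2) ^ (n - i)) sums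
      ((\<Sum>n. of_bool (n \<in> A) * (r\<^sup>2) ^ n) * (\<Sum>n. ((q * r)\<^sup>2) ^ n))"
    using summable_real_gf[OF r2, of A] qr
    by (intro Cauchy_product_sums) (auto simp: abs_mult)
  moreover have "(\<Sum>n. ((q * r)\<^sup>2) ^ n) = 1 / (1 - (q * r)\<^sup>2)"
    by (rule suminf_geometric) (use qr in simp)
  ultimately have sums2: "(\<lambda>n. \<Sum>i\<le>n. (of_bool (i \<in> A) * (r\<^sup>2) ^ i) * ((q * r)\<^sup>2) ^ (n - i)) sums
      (real_gf A (r\<^sup>2) / (1 - (q * r)\<^sup>2))"
    by (simp add: real_gf_def)
  show ?thesis
  proof (rule sums_le[OF _ sums2 sums1])
    fix n
    have "b n = of_real (\<Sum>i\<le>n. of_bool (i \<in> A) * q ^ (n - i))" by (simp add: b_def)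
    hence "(norm (b n))\<^sup>2 = (\<Sum>i\<le>n. of_bool (i \<in> A) * q ^ (n - i))\<^sup>2"
      by (simp only: norm_of_real) simp
    also have "\<dots> \<ge> (\<Sum>i\<le>n. (of_bool (i \<in> A) * q ^ (n - i))\<^sup>2)"
      using assms by (intro sum_squares_le_square_sum) auto
    finally have "(\<Sum>i\<le>n. (of_bool (i \<in> A) * q ^ (n - i))\<^sup>2) * r ^ (2 * n) \<le> (norm (b n))\<^sup>2 * r ^ (2 * n)"
      using assms by (intro mult_right_mono) auto
    moreover have "(\<Sum>i\<le>n. (of_bool (i \<in> A) * q ^ (n - i))\<^sup>2) * r ^ (2 * n) =
        (\<Sum>i\<le>n. (of_bool (i \<in> A) * (r\<^sup>2) ^ i) * ((q * r)\<^sup>2) ^ (n - i))"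
      unfolding sum_distrib_right
    proof (intro sum.cong refl)
      fix i assume "i \<in> {..n}"
      hence "r ^ (2 * n) = (r\<^sup>2) ^ i * (r\<^sup>2) ^ (n - i)" by (simp add: power_mult flip: power_add)
      moreover have "(q ^ (n - i))\<^sup>2 = (q\<^sup>2) ^ (n - i)" by (simp add: mult.commute flip: power_mult)
      ultimately show "(of_bool (i \<in> A) * q ^ (n - i))\<^sup>2 * r ^ (2 * n) =
          of_bool (i \<in> A) * (r\<^sup>2) ^ i * ((q * r)\<^sup>2) ^ (n - i)"
        by (simp add: power_mult_distrib)
    qed
    ultimately show "(\<Sum>i\<le>n. (of_bool (i \<in> A) * (r\<^sup>2) ^ i) * ((q * r)\<^sup>2) ^ (n - i)) \<le>
        (norm (b n))\<^sup>2 * r ^ (2 * 1 * n)" by simp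
  qed
qed

subsection \<open>Lower and upper bounds for the weighted mean\<close>

lemma continuous_on_sphere_power_series:
  assumes "has_power_series r b F" "i \<ge> 1" "0 \<le> r" "r \<le> 1"
  shows "continuous_on (sphere 0 r) (\<lambda>z. F (z ^ i))"
proof (rule continuous_on_compose2[OF continuous_on_power_series[OF assms(1)]])
  show "(\<lambda>z::complex. z ^ i) ` sphere 0 r \<subseteq> cball 0 r"
    using assms power_decreasing[of 1 i r] by (auto simp: norm_power)
qed (intro continuous_intros)

lemma continuous_on_sphere_set_gf:
  assumes "0 \<le> r" "r < 1" "i \<ge> 1"
  shows "continuous_on (sphere 0 r) (\<lambda>z. set_gf A (z ^ i))"
  by (rule continuous_on_sphere_power_series[OF has_power_series_set_gf]) (use assms in auto)

lemma continuous_on_sphere_geom_kernel: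
  assumes "0 \<le> q" "q \<le> 1" "0 \<le> r" "r < 1"
  shows "continuous_on (sphere 0 r) (geom_kernel q)"
  using continuous_on_sphere_power_series[OF has_power_series_geom_kernel, of q r 1] assms by simp

text \<open>In place of Hoelder's inequality, \<open>x ^ k \<ge> t ^ (k - 2) * (x^2 - t^2)\<close>
  is used pointwise. With \<open>t^2\<close> equal to half of \<open>real_gf A (r^2)\<close>, the
  preceding bound gives the weighted mean of \<open>x^2\<close> at least \<open>2 * t^2 * T\<close>,
  so \<open>t^2 * T\<close> survives the subtraction.\<close>

lemma circle_mean_lower:
  assumes "0 \<le> q" "q \<le> 1" "0 \<le> r" "r < 1" "k \<ge> 2"
  shows "sqrt (real_gf A (r\<^sup>2) / 2) ^ k / (1 - (q * r)\<^sup>2) \<le>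
           circle_mean r (\<lambda>z. norm (set_gf A z) ^ k * (norm (geom_kernel q z))\<^sup>2)"
proof -
  define t where "t = sqrt (real_gf A (r\<^sup>2) / 2)"
  define T where "T = 1 / (1 - (q * r)\<^sup>2)"
  have r2: "0 \<le> r\<^sup>2" "r\<^sup>2 < 1" using assms by (auto simp: abs_square_less_1)
  have t: "t \<ge> 0" "t\<^sup>2 = real_gf A (r\<^sup>2) / 2"
    using real_gf_nonneg[OF r2, of A] by (auto simp: t_def)
  note cont = continuous_on_sphere_geom_kernel[OF assms(1-4)]
    continuous_on_sphere_set_gf[of r 1 A, simplified]
  define \<phi> where "\<phi> = (\<lambda>z. t ^ (k - 2) * ((norm (set_gf A z * geom_kernel q z))\<^sup>2 + (- (t\<^sup>2)) * (norm (geom_kernel q z))\<^sup>2))"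
  have "circle_mean r \<phi> \<le> circle_mean r (\<lambda>z. norm (set_gf A z) ^ k * (norm (geom_kernel q z))\<^sup>2)"
  proof (rule circle_mean_mono)
    fix z
    define x where "x = norm (set_gf A z)"
    have "t ^ (k - 2) * (x\<^sup>2 - t\<^sup>2) \<le> x ^ k"
    proof (cases "t \<le> x")
      case True
      have "t ^ (k - 2) * (x\<^sup>2 - t\<^sup>2) \<le> x ^ (k - 2) * x\<^sup>2"
        using True t by (intro mult_mono power_mono) (auto intro: power_mono)
      also have "\<dots> = x ^ k" using assms by (metis le_add_diff_inverse2 power_add)
      finally show ?thesis .
    next
      case False
      hence "x\<^sup>2 \<le> t\<^sup>2" by (intro power_mono) (auto simp: x_def)
      hence "t ^ (k - 2) * (x\<^sup>2 - t\<^sup>2) \<le> 0" using t by (intro mult_nonneg_nonpos) auto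
      also have "0 \<le> x ^ k" by (simp add: x_def)
      finally show ?thesis .
    qed
    hence "t ^ (k - 2) * (x\<^sup>2 - t\<^sup>2) * (norm (geom_kernel q z))\<^sup>2 \<le> x ^ k * (norm (geom_kernel q z))\<^sup>2"
      by (rule mult_right_mono) auto
    thus "\<phi> z \<le> norm (set_gf A z) ^ k * (norm (geom_kernel q z))\<^sup>2"
      by (simp add: \<phi>_def x_def norm_mult power_mult_distrib algebra_simps)
  qed (use assms in \<open>auto simp: \<phi>_def intro!: continuous_intros cont\<close>)
  moreover have "circle_mean r \<phi> = t ^ (k - 2) *
      (circle_mean r (\<lambda>z. (norm (set_gf A z * geom_kernel q z))\<^sup>2) + (- (t\<^sup>2)) * circle_mean r (\<lambda>z. (norm (geom_kernel q z))\<^sup>2))"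
    unfolding \<phi>_def circle_mean_cmult[symmetric]
    by (subst circle_mean_add[symmetric])
       (use assms in \<open>auto simp: circle_mean_cmult[symmetric] intro!: continuous_intros cont\<close>)
  moreover have mT: "circle_mean r (\<lambda>z. (norm (geom_kernel q z))\<^sup>2) = T"
    unfolding T_def by (rule circle_mean_geom_kernel[OF assms(1-4)])
  moreover have "circle_mean r (\<lambda>z. (norm (set_gf A z * geom_kernel q z))\<^sup>2) \<ge> 2 * t\<^sup>2 * T"
    using circle_mean_set_gf_kernel_ge[OF assms(1-4), of A] by (simp add: t T_def)
  moreover have "t ^ (k - 2) * (2 * t\<^sup>2 * T + (- (t\<^sup>2)) * T) \<le>
      t ^ (k - 2) * (circle_mean r (\<lambda>z. (norm (set_gf A z * geom_kernel q z))\<^sup>2) + (- (t\<^sup>2)) * T)"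
    using t calculation by (intro mult_left_mono add_right_mono) auto
  ultimately have "t ^ (k - 2) * (2 * t\<^sup>2 * T + (- (t\<^sup>2)) * T) \<le>
      circle_mean r (\<lambda>z. norm (set_gf A z) ^ k * (norm (geom_kernel q z))\<^sup>2)"
    by (simp only: mT)
  moreover have "t ^ (k - 2) * (2 * t\<^sup>2 * T + (- (t\<^sup>2)) * T) = (t ^ (k - 2) * t\<^sup>2) * T"
    by (simp add: algebra_simps)
  moreover have "t ^ (k - 2) * t\<^sup>2 = t ^ k" using assms by (metis le_add_diff_inverse2 power_add)
  ultimately show ?thesis by (simp add: t_def T_def)
qed

text \<open>The threshold is \<open>x = 1 / \<eta>\<close>: above it the first term suffices, below
  it the second.\<close>

lemma power_le_scaled_next_power:
  fixes x :: real
  assumes "x \<ge> 0" "\<eta> > 0" "k \<ge> 1"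
  shows "x ^ (k - 1) \<le> \<eta> * x ^ k + (1 / \<eta>) ^ (k - 1)"
proof (cases "x \<ge> 1 / \<eta>")
  case True
  hence "1 \<le> \<eta> * x" using assms by (simp add: field_simps)
  hence "1 * x ^ (k - 1) \<le> (\<eta> * x) * x ^ (k - 1)" using assms by (intro mult_right_mono) auto
  also have "\<dots> = \<eta> * x ^ k" using assms by (cases k) auto
  finally show ?thesis using assms by (simp add: add_increasing2)
next
  case False
  hence "x ^ (k - 1) \<le> (1 / \<eta>) ^ (k - 1)" using assms by (intro power_mono) auto
  thus ?thesis using assms by (simp add: add_increasing)
qed

text \<open>Two moves are combined: replacing \<open>z ^ i\<close> by \<open>z\<close>, at the cost
  of \<open>(2 * i + 1)^2\<close>, and raising the exponent from \<open>k - 1\<close> to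
  \<open>k\<close>, which yields the small factor \<open>\<eta>\<close> and a multiple of
  \<open>T\<close>.\<close>

lemma circle_mean_tail:
  fixes A :: "nat set"
  assumes q: "0 \<le> q" "q < 1" "0 \<le> r" "r < 1" and "k \<ge> 2" "i \<ge> 1" "\<eta> > 0"
  defines "J \<equiv> circle_mean r (\<lambda>z. norm (set_gf A z) ^ k * (norm (geom_kernel q z))\<^sup>2)"
  defines "T \<equiv> circle_mean r (\<lambda>z. (norm (geom_kernel q z))\<^sup>2)"
  shows "circle_mean r (\<lambda>z. norm (set_gf A (z ^ i)) ^ (k - 1) * (norm (geom_kernel q z))\<^sup>2) \<le>
           (2 * real i + 1)\<^sup>2 * (\<eta> * J + (1 / \<eta>) ^ (k - 1) * T)"
proof -
  define c where "c = (2 * real i + 1)\<^sup>2"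
  have c: "c \<ge> 1" unfolding c_def by (rule one_le_power) simp
  have contG: "continuous_on (sphere 0 r) (geom_kernel q)"
    by (rule continuous_on_sphere_geom_kernel) (use q in auto)
  have contf: "continuous_on (sphere 0 r) (\<lambda>z. set_gf A (z ^ i))" if "i \<ge> 1" for i
    by (rule continuous_on_sphere_set_gf) (use q that in auto)
  have T0: "T \<ge> 0" unfolding T_def circle_mean_def by (intro divide_nonneg_nonneg integral_nonneg
        circle_mean_integrable continuous_intros contG q) auto
  \<comment> \<open>The exponent must be even for Parseval's identity to apply; for odd \<open>k\<close> the transfer is made at \<open>k - 1\<close>.\<close>
  have transfer: "circle_mean r (\<lambda>z. norm (set_gf A (z ^ i)) ^ (2 * m) * (norm (geom_kernel q z))\<^sup>2) \<le>
      c * circle_mean r (\<lambda>z. norm (set_gf A z) ^ (2 * m) * (norm (geom_kernel q z))\<^sup>2)" for m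
  proof -
    obtain e where e: "has_power_series r e (\<lambda>z. set_gf A z ^ m * geom_kernel q z)"
      using has_power_series_power_mult[OF has_power_series_set_gf has_power_series_geom_kernel] q
      by (metis less_imp_le)
    have sq: "(norm (set_gf A w ^ m * geom_kernel q w))\<^sup>2 = norm (set_gf A w) ^ (2 * m) * (norm (geom_kernel q w))\<^sup>2" for w
      by (simp add: norm_mult norm_power power_mult_distrib mult.commute flip: power_mult)
    have "circle_mean r (\<lambda>z. norm (set_gf A (z ^ i)) ^ (2 * m) * (norm (geom_kernel q z))\<^sup>2) \<le>
        circle_mean r (\<lambda>z. c * (norm (set_gf A (z ^ i) ^ m * geom_kernel q (z ^ i)))\<^sup>2)"
    proof (rule circle_mean_mono)
      fix z :: complex assume z: "norm z = r"
      have "(norm (geom_kernel q z))\<^sup>2 \<le> ((2 * real i + 1) * norm (geom_kernel q (z ^ i)))\<^sup>2"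
        using z q by (intro power_mono norm_geom_kernel_le_power) auto
      hence "norm (set_gf A (z ^ i)) ^ (2 * m) * (norm (geom_kernel q z))\<^sup>2 \<le>
          norm (set_gf A (z ^ i)) ^ (2 * m) * ((2 * real i + 1) * norm (geom_kernel q (z ^ i)))\<^sup>2"
        by (rule mult_left_mono) auto
      thus "norm (set_gf A (z ^ i)) ^ (2 * m) * (norm (geom_kernel q z))\<^sup>2 \<le>
          c * (norm (set_gf A (z ^ i) ^ m * geom_kernel q (z ^ i)))\<^sup>2"
        unfolding sq by (simp add: c_def power_mult_distrib mult_ac)
    next
      have "continuous_on (sphere 0 r) (\<lambda>z. set_gf A (z ^ i) ^ m * geom_kernel q (z ^ i))"
        using continuous_on_sphere_power_series[OF e] assms by simp
      thus "continuous_on (sphere 0 r) (\<lambda>z. c * (norm (set_gf A (z ^ i) ^ m * geom_kernel q (z ^ i)))\<^sup>2)"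
        by (intro continuous_on_mult_left continuous_on_power continuous_on_norm)
    qed (use assms in \<open>auto intro!: continuous_intros contG contf\<close>)
    also have "\<dots> \<le> c * circle_mean r (\<lambda>z. (norm (set_gf A z ^ m * geom_kernel q z))\<^sup>2)"
      unfolding circle_mean_cmult using c circle_mean_power_le[OF e, of i] assms
      by (intro mult_left_mono) auto
    finally show ?thesis by (simp add: sq)
  qed
  have step: "circle_mean r (\<lambda>z. norm (set_gf A (z ^ j)) ^ (k - 1) * (norm (geom_kernel q z))\<^sup>2) \<le>
      \<eta> * circle_mean r (\<lambda>z. norm (set_gf A (z ^ j)) ^ k * (norm (geom_kernel q z))\<^sup>2) + (1 / \<eta>) ^ (k - 1) * T"
    if "j \<ge> 1" for j
  proof -
    have "circle_mean r (\<lambda>z. norm (set_gf A (z ^ j)) ^ (k - 1) * (norm (geom_kernel q z))\<^sup>2) \<le>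
        circle_mean r (\<lambda>z. \<eta> * (norm (set_gf A (z ^ j)) ^ k * (norm (geom_kernel q z))\<^sup>2) +
          (1 / \<eta>) ^ (k - 1) * (norm (geom_kernel q z))\<^sup>2)"
    proof (rule circle_mean_mono)
      fix z
      show "norm (set_gf A (z ^ j)) ^ (k - 1) * (norm (geom_kernel q z))\<^sup>2 \<le>
          \<eta> * (norm (set_gf A (z ^ j)) ^ k * (norm (geom_kernel q z))\<^sup>2) + (1 / \<eta>) ^ (k - 1) * (norm (geom_kernel q z))\<^sup>2"
        using mult_right_mono[OF power_le_scaled_next_power[of "norm (set_gf A (z ^ j))" \<eta> k],
            of "(norm (geom_kernel q z))\<^sup>2"] assms by (simp add: distrib_right mult.assoc)
    qed (use assms that in \<open>auto intro!: continuous_intros contG contf\<close>)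
    also have "\<dots> = circle_mean r (\<lambda>z. \<eta> * (norm (set_gf A (z ^ j)) ^ k * (norm (geom_kernel q z))\<^sup>2)) +
        circle_mean r (\<lambda>z. (1 / \<eta>) ^ (k - 1) * (norm (geom_kernel q z))\<^sup>2)"
      by (rule circle_mean_add) (use assms that in \<open>auto intro!: continuous_intros contG contf\<close>)
    finally show ?thesis by (simp only: circle_mean_cmult T_def)
  qed
  have "circle_mean r (\<lambda>z. norm (set_gf A (z ^ i)) ^ (k - 1) * (norm (geom_kernel q z))\<^sup>2) \<le>
      c * (\<eta> * J + (1 / \<eta>) ^ (k - 1) * T)"
  \<comment> \<open>For even \<open>k\<close> the exponent is raised first, at \<open>z ^ i\<close>,
    and \<open>c \<ge> 1\<close> lets the \<open>T\<close> term fit under the common factor. For odd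
    \<open>k\<close> the transfer comes first and the exponent is raised at
    \<open>z\<close>.\<close>
  proof (cases "even k")
    case True
    then obtain m where m: "k = 2 * m" by blast
    have "\<eta> * circle_mean r (\<lambda>z. norm (set_gf A (z ^ i)) ^ k * (norm (geom_kernel q z))\<^sup>2) \<le> \<eta> * (c * J)"
      using transfer[of m] assms by (intro mult_left_mono) (auto simp: m J_def)
    moreover have "(1 / \<eta>) ^ (k - 1) * T \<le> c * ((1 / \<eta>) ^ (k - 1) * T)"
      using mult_right_mono[OF c, of "(1 / \<eta>) ^ (k - 1) * T"] T0 assms(7) by simp
    ultimately show ?thesis using step[of i] assms(6) by (simp add: algebra_simps)
  next
    case False
    then obtain m where m: "k - 1 = 2 * m" by (auto elim!: oddE)
    have "c * circle_mean r (\<lambda>z. norm (set_gf A z) ^ (k - 1) * (norm (geom_kernel q z))\<^sup>2) \<le>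
        c * (\<eta> * J + (1 / \<eta>) ^ (k - 1) * T)"
      using step[of 1] c by (intro mult_left_mono) (auto simp: J_def)
    thus ?thesis using transfer[of m, folded m] by linarith
  qed
  thus ?thesis by (simp add: c_def)
qed

text \<open>\<open>C\<close> is fixed before the set, the radii and the series, because these vary
  with \<open>N\<close> in the application. The free parameter \<open>s\<close> weighs the error
  series against the kernel.\<close>

lemma circle_mean_upper:
  assumes R: "R \<in> {(\<le>), (<)}" and k: "k \<ge> 2"
  obtains C :: real where "C > 0"
    "\<And>A q r c s E e. 0 \<le> q \<Longrightarrow> q < 1 \<Longrightarrow> 0 \<le> r \<Longrightarrow> r < 1 \<Longrightarrow> c > 0 \<Longrightarrow> s > 0 \<Longrightarrow>
       has_power_series r e E \<Longrightarrow>
       (\<And>z. norm z = r \<Longrightarrow> rep_gf R k A z = of_real c / (1 - z) + (1 - z) * E z) \<Longrightarrow>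
       circle_mean r (\<lambda>z. norm (set_gf A z) ^ k * (norm (geom_kernel q z))\<^sup>2) \<le>
         2 * fact k * (c * (1 / (1 - q))\<^sup>2 * circle_mean r (\<lambda>z. 1 / norm (1 - z)) +
           1 / s * circle_mean r (\<lambda>z. (norm (E z))\<^sup>2)) +
         (2 * fact k * s + C) * circle_mean r (\<lambda>z. (norm (geom_kernel q z))\<^sup>2)"
proof -
  define D where "D = fact k * real k * (2 * real k + 1)\<^sup>2"
  have D: "D > 0" unfolding D_def using k by (intro mult_pos_pos) auto
  \<comment> \<open>\<open>D\<close> bounds the total factor of the \<open>k\<close> lower order
    terms, so with this \<open>\<eta>\<close> they return \<open>J\<close> with coefficient
    \<open>1 / 2\<close>.\<close>
  define \<eta> where "\<eta> = 1 / (2 * D)"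
  have \<eta>: "\<eta> > 0" using D by (simp add: \<eta>_def)
  define C where "C = 2 * (fact k + D * (1 / \<eta>) ^ (k - 1))"
  have "C > 0" unfolding C_def using D \<eta> by (intro mult_pos_pos add_pos_pos) auto
  moreover have "circle_mean r (\<lambda>z. norm (set_gf A z) ^ k * (norm (geom_kernel q z))\<^sup>2) \<le>
         2 * fact k * (c * (1 / (1 - q))\<^sup>2 * circle_mean r (\<lambda>z. 1 / norm (1 - z)) +
           1 / s * circle_mean r (\<lambda>z. (norm (E z))\<^sup>2)) +
         (2 * fact k * s + C) * circle_mean r (\<lambda>z. (norm (geom_kernel q z))\<^sup>2)"
    if q: "0 \<le> q" "q < 1" and r: "0 \<le> r" "r < 1" and c: "c > 0" and s: "s > 0"
      and E: "has_power_series r e E"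
      and H: "\<And>z. norm z = r \<Longrightarrow> rep_gf R k A z = of_real c / (1 - z) + (1 - z) * E z"
    for A q r c s E e
  proof -
    define G where "G = geom_kernel q"
    define f where "f = set_gf A"
    define J where "J = circle_mean r (\<lambda>z. norm (f z) ^ k * (norm (G z))\<^sup>2)"
    define T where "T = circle_mean r (\<lambda>z. (norm (G z))\<^sup>2)"
    define L where "L = circle_mean r (\<lambda>z. 1 / norm (1 - z))"
    define EE where "EE = circle_mean r (\<lambda>z. (norm (E z))\<^sup>2)"
    have contG: "continuous_on (sphere 0 r) G"
      unfolding G_def by (rule continuous_on_sphere_geom_kernel) (use q r in auto)
    have contf: "continuous_on (sphere 0 r) (\<lambda>z. f (z ^ i))" if "i \<ge> 1" for i
      unfolding f_def by (rule continuous_on_sphere_set_gf) (use r that in auto)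
    note contf1 = contf[of 1, simplified]
    have contE: "continuous_on (sphere 0 r) E"
      using continuous_on_sphere_power_series[OF E, of 1] r by simp
    have contL: "continuous_on (sphere 0 r) (\<lambda>z::complex. 1 / norm (1 - z))"
      using r by (intro continuous_intros) auto
    note cont = contG contf contf1 contE contL
    \<comment> \<open>\<open>u1\<close> comes from the pole, \<open>u3\<close> from the error
      series, \<open>u4\<close> from the lower order terms. \<open>u2\<close> gathers the multiples
      of the squared kernel: one from splitting the error term, one from the constant 1 in
      \<open>rep_gf_approx\<close>.\<close>
    define u1 where "u1 = (\<lambda>z::complex. (fact k * c * (1 / (1 - q))\<^sup>2) * (1 / norm (1 - z)))"
    define u2 where "u2 = (\<lambda>z. (fact k * s + fact k) * (norm (G z))\<^sup>2)"
    define u3 where "u3 = (\<lambda>z. (fact k * (1 / s)) * (norm (E z))\<^sup>2)"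
    define u4 where "u4 = (\<lambda>i z. norm (f (z ^ i)) ^ (k - 1) * (norm (G z))\<^sup>2)"
    have cu: "continuous_on (sphere 0 r) u1" "continuous_on (sphere 0 r) u2" "continuous_on (sphere 0 r) u3"
      "\<And>i. i \<in> {1..k} \<Longrightarrow> continuous_on (sphere 0 r) (u4 i)"
      unfolding u1_def u2_def u3_def u4_def by (intro continuous_on_mult continuous_on_const continuous_on_power continuous_on_norm cont; simp)+
    have cu4: "continuous_on (sphere 0 r) (\<lambda>z. \<Sum>i=1..k. u4 i z)"
      by (intro continuous_on_sum cu)
    have "J \<le> circle_mean r (\<lambda>z. (u1 z + u2 z) + (u3 z + fact k * (\<Sum>i=1..k. u4 i z)))"
      unfolding J_def
    proof (rule circle_mean_mono)
      fix z :: complex assume z: "norm z = r"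
      define g where "g = norm (G z)"
      define \<Sigma> where "\<Sigma> = (\<Sum>i=1..k. norm (f (z ^ i)) ^ (k - 1))"
      have g0: "g \<ge> 0" by (simp add: g_def)
      have "norm (f z) ^ k = norm (fact k * rep_gf R k A z - (fact k * rep_gf R k A z - f z ^ k))"
        by (simp add: norm_power)
      also have "\<dots> \<le> norm (fact k * rep_gf R k A z) + norm (fact k * rep_gf R k A z - f z ^ k)"
        by (rule norm_triangle_ineq4)
      also have "norm (fact k * rep_gf R k A z) = fact k * norm (rep_gf R k A z)"
        by (simp add: norm_mult)
      also have "norm (fact k * rep_gf R k A z - f z ^ k) \<le> fact k * (1 + \<Sigma>)"
        unfolding f_def \<Sigma>_def by (rule rep_gf_approx[OF R]) (use z r k in auto)
      finally have 1: "norm (f z) ^ k \<le> fact k * norm (rep_gf R k A z) + fact k * (1 + \<Sigma>)" by simp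
      have "norm (rep_gf R k A z) \<le> norm (of_real c / (1 - z)) + norm ((1 - z) * E z)"
        unfolding H[OF z] by (rule norm_triangle_ineq)
      also have "\<dots> = c * (1 / norm (1 - z)) + norm (1 - z) * norm (E z)"
        using c by (simp add: norm_divide norm_mult)
      finally have "fact k * norm (rep_gf R k A z) \<le> fact k * (c * (1 / norm (1 - z)) + norm (1 - z) * norm (E z))"
        by (rule mult_left_mono) auto
      with 1 have "norm (f z) ^ k \<le> fact k * (c * (1 / norm (1 - z)) + norm (1 - z) * norm (E z)) + fact k * (1 + \<Sigma>)"
        by linarith
      hence "norm (f z) ^ k * g\<^sup>2 \<le> (fact k * (c * (1 / norm (1 - z)) + norm (1 - z) * norm (E z)) + fact k * (1 + \<Sigma>)) * g\<^sup>2"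
        by (rule mult_right_mono) auto
      also have "\<dots> = fact k * (c * (1 / norm (1 - z)) * g\<^sup>2) + fact k * ((norm (1 - z) * g) * g * norm (E z)) +
          fact k * g\<^sup>2 + fact k * (\<Sigma> * g\<^sup>2)"
        by (simp add: algebra_simps power2_eq_square)
      also have "\<dots> \<le> fact k * (c * (1 / norm (1 - z)) * (1 / (1 - q))\<^sup>2) +
          fact k * (s * g\<^sup>2 + 1 / s * (norm (E z))\<^sup>2) + fact k * g\<^sup>2 + fact k * (\<Sigma> * g\<^sup>2)"
      proof (intro add_mono order.refl mult_left_mono[of _ _ "fact k"])
        show "c * (1 / norm (1 - z)) * g\<^sup>2 \<le> c * (1 / norm (1 - z)) * (1 / (1 - q))\<^sup>2"
          unfolding g_def G_def using c z r q
          by (intro mult_left_mono power_mono norm_geom_kernel_le) auto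
        \<comment> \<open>One kernel factor cancels \<open>1 - z\<close>; the other is separated
          from \<open>E z\<close> by the inequality between arithmetic and geometric means.\<close>
        have "(norm (1 - z) * g) * g * norm (E z) \<le> 2 * g * norm (E z)"
          using norm_one_minus_times_geom_kernel[of z q] z r q g0
          by (intro mult_right_mono) (auto simp: g_def G_def)
        also have "2 * g * norm (E z) \<le> s * g\<^sup>2 + 1 / s * (norm (E z))\<^sup>2"
        proof -
          have "0 \<le> (s * g - norm (E z))\<^sup>2 / s" using s by simp
          also have "\<dots> = s * g\<^sup>2 + 1 / s * (norm (E z))\<^sup>2 - 2 * g * norm (E z)"
            using s by (simp add: power2_diff field_simps power2_eq_square)
          finally show ?thesis by simp
        qed
        finally show "(norm (1 - z) * g) * g * norm (E z) \<le> s * g\<^sup>2 + 1 / s * (norm (E z))\<^sup>2" .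
      qed auto
      also have "\<dots> = (u1 z + u2 z) + (u3 z + fact k * (\<Sum>i=1..k. u4 i z))"
        by (simp add: u1_def u2_def u3_def u4_def g_def[symmetric] \<Sigma>_def algebra_simps sum_distrib_left sum_distrib_right)
      finally show "norm (f z) ^ k * (norm (G z))\<^sup>2 \<le> (u1 z + u2 z) + (u3 z + fact k * (\<Sum>i=1..k. u4 i z))"
        by (simp add: g_def)
    qed (use r in \<open>auto intro!: continuous_intros cont cu cu4\<close>)
    also have "\<dots> = (circle_mean r u1 + circle_mean r u2) +
        (circle_mean r u3 + fact k * (\<Sum>i=1..k. circle_mean r (u4 i)))"
    proof -
      have "circle_mean r (\<lambda>z. \<Sum>i=1..k. u4 i z) = (\<Sum>i=1..k. circle_mean r (u4 i))"
        by (rule circle_mean_sum) (use cu r in auto)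
      moreover have "circle_mean r (\<lambda>z. u1 z + u2 z) = circle_mean r u1 + circle_mean r u2"
        by (rule circle_mean_add) (use cu r in auto)
      moreover have "circle_mean r (\<lambda>z. u3 z + fact k * (\<Sum>i=1..k. u4 i z)) =
          circle_mean r u3 + circle_mean r (\<lambda>z. fact k * (\<Sum>i=1..k. u4 i z))"
        by (rule circle_mean_add) (use cu cu4 r in \<open>auto intro!: continuous_on_mult_left\<close>)
      moreover have "circle_mean r (\<lambda>z. (u1 z + u2 z) + (u3 z + fact k * (\<Sum>i=1..k. u4 i z))) =
          circle_mean r (\<lambda>z. u1 z + u2 z) + circle_mean r (\<lambda>z. u3 z + fact k * (\<Sum>i=1..k. u4 i z))"
        by (rule circle_mean_add) (use cu cu4 r in \<open>auto intro!: continuous_on_mult_left continuous_on_add\<close>)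
      ultimately show ?thesis by (simp only: circle_mean_cmult)
    qed
    also have "circle_mean r u1 = fact k * c * (1 / (1 - q))\<^sup>2 * L"
      unfolding u1_def L_def by (rule circle_mean_cmult)
    also have "circle_mean r u2 = (fact k * s + fact k) * T"
      unfolding u2_def T_def by (rule circle_mean_cmult)
    also have "circle_mean r u3 = fact k * (1 / s) * EE"
      unfolding u3_def EE_def by (rule circle_mean_cmult)
    finally have main: "J \<le> fact k * c * (1 / (1 - q))\<^sup>2 * L + (fact k * s + fact k) * T +
        (fact k * (1 / s) * EE + fact k * (\<Sum>i=1..k. circle_mean r (u4 i)))" .
    have J0: "J \<ge> 0" and T0: "T \<ge> 0" unfolding J_def T_def circle_mean_def
      by (intro divide_nonneg_nonneg integral_nonneg circle_mean_integrable continuous_intros cont r; simp)+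
    have "(\<Sum>i=1..k. circle_mean r (u4 i)) \<le> (\<Sum>i=1..k. (2 * real k + 1)\<^sup>2 * (\<eta> * J + (1 / \<eta>) ^ (k - 1) * T))"
    proof (rule sum_mono)
      fix i assume i: "i \<in> {1..k}"
      have "circle_mean r (u4 i) \<le> (2 * real i + 1)\<^sup>2 * (\<eta> * J + (1 / \<eta>) ^ (k - 1) * T)"
        unfolding u4_def J_def T_def f_def G_def
        by (rule circle_mean_tail) (use q r k \<eta> i in auto)
      also have "\<dots> \<le> (2 * real k + 1)\<^sup>2 * (\<eta> * J + (1 / \<eta>) ^ (k - 1) * T)"
        using i J0 T0 \<eta> by (intro mult_right_mono power_mono add_nonneg_nonneg mult_nonneg_nonneg) auto
      finally show "circle_mean r (u4 i) \<le> (2 * real k + 1)\<^sup>2 * (\<eta> * J + (1 / \<eta>) ^ (k - 1) * T)" .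
    qed
    hence "fact k * (\<Sum>i=1..k. circle_mean r (u4 i)) \<le> fact k * (real k * ((2 * real k + 1)\<^sup>2 * (\<eta> * J + (1 / \<eta>) ^ (k - 1) * T)))"
      by (intro mult_left_mono) auto
    also have "\<dots> = D * \<eta> * J + D * (1 / \<eta>) ^ (k - 1) * T"
      by (simp add: D_def algebra_simps)
    also have "D * \<eta> = 1 / 2" using D by (simp add: \<eta>_def)
    finally have "J \<le> fact k * c * (1 / (1 - q))\<^sup>2 * L + (fact k * s + fact k) * T +
        (fact k * (1 / s) * EE + (1 / 2 * J + D * (1 / \<eta>) ^ (k - 1) * T))"
      using main by linarith
    \<comment> \<open>Half of \<open>J\<close> is absorbed on the left; this doubling is the origin
      of the factor 2 in \<open>C\<close> and in the conclusion.\<close>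
    moreover have "x \<le> 2 * (a + b + (c + d))" if "x \<le> a + b + (c + (1 / 2 * x + d))" for x a b c d :: real
      using that by simp
    ultimately have "J \<le> 2 * (fact k * c * (1 / (1 - q))\<^sup>2 * L + (fact k * s + fact k) * T +
        (fact k * (1 / s) * EE + D * (1 / \<eta>) ^ (k - 1) * T))" by blast
    also have "\<dots> = 2 * fact k * (c * (1 / (1 - q))\<^sup>2 * L + 1 / s * EE) + (2 * fact k * s + C) * T"
      unfolding C_def by (simp add: algebra_simps)
    finally show ?thesis by (simp add: J_def T_def L_def EE_def f_def G_def)
  qed
  ultimately show ?thesis by (rule that)
qed

subsection \<open>The error term\<close>

definition rep_error :: "(nat \<Rightarrow> nat \<Rightarrow> bool) \<Rightarrow> nat \<Rightarrow> nat set \<Rightarrow> real \<Rightarrow> nat \<Rightarrow> real" where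
  "rep_error R k A c n = (\<Sum>j=0..n. real (ordered_rep R k A j) - c)"

text \<open>The equation \<open>H(z) = c/(1-z) + (1-z) E(z)\<close> solved for \<open>E\<close>. The
  outer factor \<open>1 / (1 - z)\<close> turns coefficients into partial sums, which are the
  errors.\<close>

definition error_gf :: "(nat \<Rightarrow> nat \<Rightarrow> bool) \<Rightarrow> nat \<Rightarrow> nat set \<Rightarrow> real \<Rightarrow> complex \<Rightarrow> complex" where
  "error_gf R k A c z = (rep_gf R k A z - of_real c * (1 / (1 - z))) * (1 / (1 - z))"

lemma has_power_series_error_gf:
  assumes "0 \<le> r" "r < 1"
  shows "has_power_series r (\<lambda>n. of_real (rep_error R k A c n)) (error_gf R k A c)"
proof -
  have geo: "has_power_series r (\<lambda>n. 1) (\<lambda>z. 1 / (1 - z))"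
    using has_power_series_geometric[of 1 r] assms by simp
  have "has_power_series r (\<lambda>n. \<Sum>i\<le>n. (of_nat (ordered_rep R k A i) - of_real c * 1) * 1) (error_gf R k A c)"
    unfolding error_gf_def
    by (intro has_power_series_mult has_power_series_diff has_power_series_cmult geo has_power_series_rep_gf assms)
  moreover have "(\<Sum>i\<le>n. (of_nat (ordered_rep R k A i) - of_real c * 1) * 1) = complex_of_real (rep_error R k A c n)" for n
    by (simp add: rep_error_def atMost_atLeast0)
  ultimately show ?thesis by simp
qed

lemma rep_gf_eq_error_gf:
  assumes "norm z < 1"
  shows "rep_gf R k A z = of_real c / (1 - z) + (1 - z) * error_gf R k A c z"
proof -
  have "1 - z \<noteq> 0" using assms by auto
  thus ?thesis by (simp add: error_gf_def)
qed

text \<open>The majorant is linear in \<open>n\<close>, so that it sums in closed form against a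
  geometric weight, and it holds for all \<open>n\<close> at once with only \<open>N\<close> large.
  The bracket dominates \<open>sqrt n\<close> on either side of \<open>N\<close>, and
  \<open>ln n\<close> is traded for \<open>ln N\<close>.\<close>

lemma rep_error_square_bound:
  assumes small: "rep_error R k A c \<in> o(\<lambda>n. real n powr (1 / 4) * ln (real n) powr (- 1 / 2))"
    and "\<delta> > 0"
  shows "eventually (\<lambda>N. \<forall>n. (rep_error R k A c n)\<^sup>2 \<le> \<delta> / ln (real N) * (sqrt (real N) + real n / sqrt (real N))) sequentially"
proof -
  define E where "E = rep_error R k A c"
  \<comment> \<open>This constant squares to \<open>\<delta> / 2\<close>; the spare factor 2 pays
    for \<open>ln N / 2 \<le> ln n\<close>.\<close>
  have "eventually (\<lambda>n. norm (E n) \<le> sqrt (\<delta> / 2) * norm (real n powr (1 / 4) * ln (real n) powr (- 1 / 2))) sequentially"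
    unfolding E_def by (rule landau_o.smallD[OF small]) (use assms in simp)
  then obtain n1 where n1: "\<And>n. n \<ge> n1 \<Longrightarrow> \<bar>E n\<bar> \<le> sqrt (\<delta> / 2) * (real n powr (1 / 4) * ln (real n) powr (- 1 / 2))"
    by (auto simp: eventually_sequentially)
  \<comment> \<open>From 3 on the logarithm is at least 1.\<close>
  define n0 where "n0 = max n1 3"
  have ln1: "ln (real n) \<ge> 1" if "n \<ge> 3" for n
  proof -
    have "exp 1 \<le> real n" using exp_le that by linarith
    thus ?thesis using that by (subst ln_ge_iff) auto
  qed
  have sq: "(E n)\<^sup>2 \<le> \<delta> / 2 * (sqrt (real n) / ln (real n))" if "n \<ge> n0" for n
  proof -
    have n: "n \<ge> n1" "n \<ge> 3" using that by (auto simp: n0_def)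
    have "(E n)\<^sup>2 = \<bar>E n\<bar>\<^sup>2" by simp
    also have "\<dots> \<le> (sqrt (\<delta> / 2) * (real n powr (1 / 4) * ln (real n) powr (- 1 / 2)))\<^sup>2"
      by (intro power_mono n1 n) auto
    also have "\<dots> = \<delta> / 2 * ((real n powr (1 / 4))\<^sup>2 * (ln (real n) powr (- 1 / 2))\<^sup>2)"
      using assms(2) by (simp add: power_mult_distrib)
    also have "(real n powr (1 / 4))\<^sup>2 = sqrt (real n)"
      using n by (simp add: powr_power powr_half_sqrt)
    also have "(ln (real n) powr (- 1 / 2))\<^sup>2 = 1 / ln (real n)"
    proof -
      have "(ln (real n) powr (- 1 / 2))\<^sup>2 = ln (real n) powr (- 1 / 2 + - 1 / 2)"
        unfolding power2_eq_square by (rule powr_add[symmetric])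
      thus ?thesis using ln1[OF n(2)] by (simp add: powr_minus_divide)
    qed
    finally show ?thesis by simp
  qed
  define B where "B = (\<Sum>n<n0. (E n)\<^sup>2)"
  have B: "(E n)\<^sup>2 \<le> B" if "n < n0" for n
    unfolding B_def by (rule member_le_sum) (use that in auto)
  have "filterlim (\<lambda>N. sqrt (real N) / ln (real N)) at_top sequentially" by real_asymp
  hence ev1: "eventually (\<lambda>N. B / \<delta> \<le> sqrt (real N) / ln (real N)) sequentially"
    by (simp add: filterlim_at_top)
  have ev2: "eventually (\<lambda>N. sqrt (sqrt (real N)) \<le> sqrt (real N) / ln (real N)) sequentially"
    by real_asymp
  show ?thesis
    using ev1 ev2 eventually_ge_at_top[of 3]
  proof eventually_elim
    case (elim N)
    have lnN: "ln (real N) \<ge> 1" using ln1 elim by simp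
    have sN: "sqrt (real N) > 0" using elim by simp
    show ?case
    proof
      fix n
      have split: "\<delta> / ln (real N) * (sqrt (real N) + real n / sqrt (real N)) =
          \<delta> * (sqrt (real N) / ln (real N)) + \<delta> / ln (real N) * (real n / sqrt (real N))"
        by (simp add: algebra_simps)
      have nn: "\<delta> / ln (real N) * (real n / sqrt (real N)) \<ge> 0"
        using assms lnN by (intro mult_nonneg_nonneg) auto
      \<comment> \<open>The finitely many small \<open>n\<close> are absorbed because
        \<open>sqrt N / ln N\<close> is unbounded. Up to \<open>sqrt N\<close> the trivial
        \<open>ln n \<ge> 1\<close> suffices, as \<open>sqrt n\<close> is at most the fourth root of
        \<open>N\<close>. Beyond that, \<open>ln n\<close> is at least half of
        \<open>ln N\<close>.\<close>
      consider "n < n0" | "n \<ge> n0" "real n \<le> sqrt (real N)" | "n \<ge> n0" "real n > sqrt (real N)"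
        by linarith
      thus "(rep_error R k A c n)\<^sup>2 \<le> \<delta> / ln (real N) * (sqrt (real N) + real n / sqrt (real N))"
        unfolding E_def[symmetric]
      proof cases
        case 1
        have "B \<le> \<delta> * (sqrt (real N) / ln (real N))" using elim(1) assms(2) by (simp add: pos_divide_le_eq mult.commute)
        thus "(E n)\<^sup>2 \<le> \<delta> / ln (real N) * (sqrt (real N) + real n / sqrt (real N))"
          using B[OF 1] nn unfolding split by linarith
      next
        case 2
        have "(E n)\<^sup>2 \<le> \<delta> / 2 * (sqrt (real n) / ln (real n))" by (rule sq[OF 2(1)])
        also have "\<dots> \<le> \<delta> * (sqrt (sqrt (real N)) / 1)"
          using assms(2) 2 ln1[of n] by (intro mult_mono frac_le) (auto simp: n0_def)
        also have "\<dots> \<le> \<delta> * (sqrt (real N) / ln (real N))"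
          using elim(2) assms(2) by (intro mult_left_mono) auto
        finally show "(E n)\<^sup>2 \<le> \<delta> / ln (real N) * (sqrt (real N) + real n / sqrt (real N))"
          using nn unfolding split by linarith
      next
        case 3
        have n3: "n \<ge> 3" using 3 by (simp add: n0_def)
        have "ln (sqrt (real N)) \<le> ln (real n)" using 3 n3 sN by (subst ln_le_cancel_iff) auto
        hence ln: "ln (real N) / 2 \<le> ln (real n)" using elim by (simp add: ln_sqrt)
        have "sqrt (real n) \<le> sqrt (real N) + real n / sqrt (real N)"
        proof (cases "n \<le> N")
          case True
          thus ?thesis using sN by (auto intro!: add_increasing2)
        next
          case False
          have "sqrt (real n) = real n / sqrt (real n)" by (simp add: real_div_sqrt)
          also have "\<dots> \<le> real n / sqrt (real N)" using False sN by (intro divide_left_mono) auto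
          finally show ?thesis using sN by linarith
        qed
        hence "\<delta> / 2 * (sqrt (real n) / ln (real n)) \<le> \<delta> / 2 * ((sqrt (real N) + real n / sqrt (real N)) / (ln (real N) / 2))"
          using ln lnN assms(2) by (intro mult_left_mono frac_le add_nonneg_nonneg) auto
        also have "\<dots> = \<delta> / ln (real N) * (sqrt (real N) + real n / sqrt (real N))"
          using lnN by (simp add: field_simps)
        finally show "(E n)\<^sup>2 \<le> \<delta> / ln (real N) * (sqrt (real N) + real n / sqrt (real N))"
          using sq[OF 3(1)] by linarith
      qed
    qed
  qed
qed

section \<open>Size of the error series on the circle and at a real point\<close>

lemma inverse_one_minus_square_le:
  assumes "N \<ge> 2"
  shows "1 / (1 - (1 - 1 / real N)\<^sup>2) \<le> real N"
proof -
  define r where "r = 1 - 1 / real N"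
  have r: "0 < r" "r < 1" using assms by (auto simp: r_def field_simps)
  hence "r\<^sup>2 < 1" by (simp add: abs_square_less_1)
  moreover have "r\<^sup>2 \<le> r" using r by (simp add: power2_eq_square mult_left_le_one_le)
  ultimately have "1 / (1 - r\<^sup>2) \<le> 1 / (1 / real N)"
    using assms by (intro divide_left_mono) (auto simp: r_def)
  thus ?thesis by (simp add: r_def)
qed

text \<open>As \<open>1 / (1 - r^2) \<le> N\<close>, the constant part is bounded through
  \<open>sqrt N * N\<close> and the linear part through \<open>N^2 / sqrt N\<close>. These agree,
  hence the factor 2.\<close>

lemma sums_error_majorant:
  assumes "N \<ge> 2" "\<delta> \<ge> 0"
  defines "r \<equiv> 1 - 1 / real N"
  obtains S where "(\<lambda>n. \<delta> / ln (real N) * (sqrt (real N) + real n / sqrt (real N)) * (r\<^sup>2) ^ n) sums S"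
    "S \<le> 2 * \<delta> * (real N * sqrt (real N)) / ln (real N)"
proof -
  have r: "0 < r" "r < 1" using assms by (auto simp: r_def field_simps)
  have r2: "0 \<le> r\<^sup>2" "r\<^sup>2 < 1" using r by (auto simp: abs_square_less_1)
  have inv: "1 / (1 - r\<^sup>2) \<le> real N"
    unfolding r_def by (rule inverse_one_minus_square_le[OF assms(1)])
  have lnN: "ln (real N) > 0" using assms by simp
  define a where "a = \<delta> / ln (real N) * sqrt (real N)"
  define d where "d = \<delta> / ln (real N) / sqrt (real N)"
  have ad: "a \<ge> 0" "d \<ge> 0" using assms lnN by (auto simp: a_def d_def)
  have s1: "(\<lambda>n. a * (r\<^sup>2) ^ n) sums (a * (1 / (1 - r\<^sup>2)))"
    by (intro sums_mult geometric_sums) (use r2 in auto)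
  \<comment> \<open>The derivative of the geometric series has coefficients \<open>n + 1\<close>;
    \<open>s3\<close> takes off the surplus.\<close>
  have s2: "(\<lambda>n. d * (of_nat (Suc n) * (r\<^sup>2) ^ n)) sums (d * (1 / (1 - r\<^sup>2)\<^sup>2))"
    by (intro sums_mult geometric_deriv_sums) (use r2 in auto)
  have s3: "(\<lambda>n. d * (r\<^sup>2) ^ n) sums (d * (1 / (1 - r\<^sup>2)))"
    by (intro sums_mult geometric_sums) (use r2 in auto)
  define S where "S = a * (1 / (1 - r\<^sup>2)) + d * (1 / (1 - r\<^sup>2)\<^sup>2) - d * (1 / (1 - r\<^sup>2))"
  have "(\<lambda>n. a * (r\<^sup>2) ^ n + d * (of_nat (Suc n) * (r\<^sup>2) ^ n) - d * (r\<^sup>2) ^ n) sums S"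
    unfolding S_def by (intro sums_diff sums_add s1 s2 s3)
  moreover have "a * (r\<^sup>2) ^ n + d * (of_nat (Suc n) * (r\<^sup>2) ^ n) - d * (r\<^sup>2) ^ n =
      \<delta> / ln (real N) * (sqrt (real N) + real n / sqrt (real N)) * (r\<^sup>2) ^ n" for n
    by (simp add: a_def d_def algebra_simps)
  ultimately have "(\<lambda>n. \<delta> / ln (real N) * (sqrt (real N) + real n / sqrt (real N)) * (r\<^sup>2) ^ n) sums S" by simp
  moreover have "S \<le> 2 * \<delta> * (real N * sqrt (real N)) / ln (real N)"
  proof -
    have "S \<le> a * (1 / (1 - r\<^sup>2)) + d * (1 / (1 - r\<^sup>2))\<^sup>2"
      using ad r2 by (simp add: S_def power_one_over)
    also have "\<dots> \<le> a * real N + d * (real N)\<^sup>2"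
      using ad inv r2 by (intro add_mono mult_left_mono power_mono) auto
    also have "d * (real N)\<^sup>2 = a * real N"
    proof -
      have "(real N)\<^sup>2 / sqrt (real N) = real N * sqrt (real N)"
        by (simp add: power2_eq_square real_div_sqrt flip: times_divide_eq_right)
      moreover have "d * (real N)\<^sup>2 = \<delta> / ln (real N) * ((real N)\<^sup>2 / sqrt (real N))"
        by (simp add: d_def)
      ultimately show ?thesis by (simp add: a_def)
    qed
    finally show ?thesis by (simp add: a_def mult_ac)
  qed
  ultimately show ?thesis by (rule that)
qed

text \<open>Parseval's weights on the circle of radius \<open>r\<close> are the powers of
  \<open>r^2\<close>, exactly those in the value at \<open>r^2\<close>, so one majorant serves both
  bounds.\<close>

lemma error_gf_bounds:
  assumes "N \<ge> 2" "\<delta> \<ge> 0"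
    and bd: "\<And>n. (rep_error R k A c n)\<^sup>2 \<le> \<delta> / ln (real N) * (sqrt (real N) + real n / sqrt (real N))"
  defines "r \<equiv> 1 - 1 / real N"
  shows "circle_mean r (\<lambda>z. (norm (error_gf R k A c z))\<^sup>2) \<le> 2 * \<delta> * (real N * sqrt (real N)) / ln (real N)"
    and "norm (error_gf R k A c (of_real (r\<^sup>2))) \<le> real N + 2 * \<delta> * (real N * sqrt (real N)) / ln (real N)"
proof -
  obtain S where S: "(\<lambda>n. \<delta> / ln (real N) * (sqrt (real N) + real n / sqrt (real N)) * (r\<^sup>2) ^ n) sums S"
    "S \<le> 2 * \<delta> * (real N * sqrt (real N)) / ln (real N)"
    by (rule sums_error_majorant[OF assms(1,2), folded r_def])
  have r: "0 < r" "r < 1" using assms by (auto simp: r_def field_simps)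
  have r2: "0 \<le> r\<^sup>2" "r\<^sup>2 < 1" using r by (auto simp: abs_square_less_1)
  have inv: "1 / (1 - r\<^sup>2) \<le> real N"
    unfolding r_def by (rule inverse_one_minus_square_le[OF assms(1)])
  have "circle_mean r (\<lambda>z. (norm (error_gf R k A c z))\<^sup>2) \<le> S"
  proof (rule sums_le[OF _ _ S(1)])
    show "(\<lambda>n. (norm (complex_of_real (rep_error R k A c n)))\<^sup>2 * r ^ (2 * 1 * n)) sums
        circle_mean r (\<lambda>z. (norm (error_gf R k A c z))\<^sup>2)"
      using parseval[OF has_power_series_error_gf, of r 1] r by simp
    show "(norm (complex_of_real (rep_error R k A c n)))\<^sup>2 * r ^ (2 * 1 * n) \<le>
        \<delta> / ln (real N) * (sqrt (real N) + real n / sqrt (real N)) * (r\<^sup>2) ^ n" for n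
      using mult_right_mono[OF bd[of n], of "(r\<^sup>2) ^ n"] r2 by (simp add: power_mult)
  qed
  thus "circle_mean r (\<lambda>z. (norm (error_gf R k A c z))\<^sup>2) \<le> 2 * \<delta> * (real N * sqrt (real N)) / ln (real N)"
    using S(2) by linarith
  have "(\<lambda>n. (r\<^sup>2) ^ n) sums (1 / (1 - r\<^sup>2))" by (rule geometric_sums) (use r2 in auto)
  from sums_add[OF this S(1)]
  have maj: "(\<lambda>n. (r\<^sup>2) ^ n + \<delta> / ln (real N) * (sqrt (real N) + real n / sqrt (real N)) * (r\<^sup>2) ^ n) sums (1 / (1 - r\<^sup>2) + S)" .
  have "(\<lambda>n. complex_of_real (rep_error R k A c n) * of_real (r\<^sup>2) ^ n) sums error_gf R k A c (of_real (r\<^sup>2))"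
  proof -
    have "norm (complex_of_real (r\<^sup>2)) \<le> r\<^sup>2"
      using r2 by (simp only: norm_of_real abs_of_nonneg order.refl)
    thus ?thesis
      using has_power_series_error_gf[of "r\<^sup>2" R k A c] r2 unfolding has_power_series_def by blast
  qed
  hence "error_gf R k A c (of_real (r\<^sup>2)) = (\<Sum>n. complex_of_real (rep_error R k A c n) * of_real (r\<^sup>2) ^ n)"
    by (rule sums_unique)
  also have "norm \<dots> \<le> (\<Sum>n. (r\<^sup>2) ^ n + \<delta> / ln (real N) * (sqrt (real N) + real n / sqrt (real N)) * (r\<^sup>2) ^ n)"
  proof (rule norm_suminf_le)
    fix n
    define x where "x = rep_error R k A c n"
    \<comment> \<open>Reduces the first power to the square; the extra 1 sums to the term
      \<open>N\<close>.\<close>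
    have "\<bar>x\<bar> \<le> 1 + x\<^sup>2" using zero_le_power2[of "\<bar>x\<bar> - 1 / 2"] by (simp add: power2_diff power_divide)
    hence "\<bar>x\<bar> * (r\<^sup>2) ^ n \<le> (1 + \<delta> / ln (real N) * (sqrt (real N) + real n / sqrt (real N))) * (r\<^sup>2) ^ n"
      using bd[of n] r2 unfolding x_def by (intro mult_right_mono) auto
    thus "norm (complex_of_real (rep_error R k A c n) * of_real (r\<^sup>2) ^ n) \<le>
        (r\<^sup>2) ^ n + \<delta> / ln (real N) * (sqrt (real N) + real n / sqrt (real N)) * (r\<^sup>2) ^ n"
      using r2 by (simp add: norm_mult norm_power x_def distrib_right)
  qed (use maj in \<open>simp add: sums_iff\<close>)
  also have "\<dots> = 1 / (1 - r\<^sup>2) + S" using maj by (simp add: sums_iff)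
  finally show "norm (error_gf R k A c (of_real (r\<^sup>2))) \<le> real N + 2 * \<delta> * (real N * sqrt (real N)) / ln (real N)"
    using S(2) inv by linarith
qed

text \<open>At the real point \<open>x = (1 - 1/N)^2\<close> the pole has order \<open>N\<close>,
  while the error contributes at most \<open>2 + 4 * sqrt N / ln N\<close>. So the representation
  series has order at least \<open>N\<close>, and \<open>rep_gf_approx\<close> carries this over to
  the power of \<open>real_gf\<close>.\<close>

lemma real_gf_lower:
  assumes R: "R \<in> {(\<le>), (<)}" and k: "k \<ge> 2" and c: "c > 0"
    and small: "rep_error R k A c \<in> o(\<lambda>n. real n powr (1 / 4) * ln (real n) powr (- 1 / 2))"
  obtains c' where "c' > 0" "eventually (\<lambda>N. real_gf A ((1 - 1 / real N)\<^sup>2) ^ k \<ge> c' * real N) sequentially"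
proof -
  \<comment> \<open>\<open>D\<close> is the constant in
    \<open>fact k * norm H \<le> D * F ^ k\<close>; the 4 in \<open>c'\<close> stems from
    \<open>norm H \<ge> c * N / 4\<close>.\<close>
  define D :: real where "D = 1 + fact k + fact k * real k"
  have D: "D > 0" unfolding D_def by (intro add_pos_nonneg) auto
  define c' where "c' = fact k * c / (4 * D)"
  have c': "c' > 0" using c D by (simp add: c'_def)
  have ev1: "eventually (\<lambda>N. c * real N / 4 \<ge> 2 + 4 * sqrt (real N) / ln (real N)) sequentially"
    using c by real_asymp
  have ev2: "eventually (\<lambda>N. c' * real N > 1) sequentially"
    using c' by real_asymp
  show ?thesis
  proof (rule that[OF c'])
    show "eventually (\<lambda>N. real_gf A ((1 - 1 / real N)\<^sup>2) ^ k \<ge> c' * real N) sequentially"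
      using rep_error_square_bound[OF small zero_less_one] ev1 ev2 eventually_ge_at_top[of 2]
    proof eventually_elim
      case (elim N)
      define r where "r = 1 - 1 / real N"
      define x where "x = r\<^sup>2"
      have r: "0 < r" "r < 1" using elim by (auto simp: r_def field_simps)
      have x: "0 \<le> x" "x < 1" using r by (auto simp: abs_square_less_1 x_def)
      have "1 - x = (1 - r) * (1 + r)" by (simp add: x_def power2_eq_square algebra_simps)
      also have "\<dots> \<le> (1 - r) * 2" using r by (intro mult_left_mono) auto
      finally have x2: "1 - x \<le> 2 / real N" by (simp add: r_def)
      have "c * (1 / (2 / real N)) \<le> c * (1 / (1 - x))"
        using c x x2 elim(4) by (intro mult_left_mono divide_left_mono) auto
      hence cx: "c * real N / 2 \<le> c / (1 - x)" by simp
      define H where "H = rep_gf R k A (of_real x)"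
      define e where "e = error_gf R k A c (of_real x)"
      have ne: "norm e \<le> real N + 2 * 1 * (real N * sqrt (real N)) / ln (real N)"
        unfolding e_def x_def r_def by (rule error_gf_bounds(2)) (use elim in auto)
      have eq: "H = of_real (c / (1 - x)) + of_real (1 - x) * e"
        unfolding H_def e_def using x by (subst rep_gf_eq_error_gf[of _ R k A c]) (auto simp: norm_of_real)
      have "of_real (c / (1 - x)) = H - of_real (1 - x) * e" by (simp add: eq)
      hence "norm (of_real (c / (1 - x)) :: complex) \<le> norm H + norm (of_real (1 - x) * e)"
        by (metis norm_triangle_ineq4)
      hence "c / (1 - x) \<le> norm H + (1 - x) * norm e"
        using x c by (simp add: norm_mult norm_divide del: of_real_divide of_real_diff)
      also have "(1 - x) * norm e \<le> 2 / real N * (real N + 2 * 1 * (real N * sqrt (real N)) / ln (real N))"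
        using x x2 ne by (intro mult_mono) auto
      also have "\<dots> = 2 + 4 * sqrt (real N) / ln (real N)"
        using elim by (simp add: field_simps)
      finally have H: "norm H \<ge> c * real N / 4" using cx elim(2) by linarith
      define f where "f = real_gf A x"
      have f0: "f \<ge> 0" unfolding f_def by (rule real_gf_nonneg[OF x])
      \<comment> \<open>The maximum with 1 lets \<open>F ^ k\<close> dominate all lower powers. In
        the end \<open>F ^ k \<ge> c' * N > 1\<close> forces \<open>F = f\<close>.\<close>
      define F where "F = max 1 f"
      have F1: "F \<ge> 1" "f \<le> F" by (auto simp: F_def)
      have fi: "norm (set_gf A (of_real x ^ i)) \<le> f" if "i \<in> {1..k}" for i
      proof -
        have xi: "0 \<le> x ^ i" "x ^ i \<le> x" using x that power_decreasing[of 1 i x] by auto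
        have "set_gf A (of_real x ^ i) = of_real (real_gf A (x ^ i))"
          using set_gf_of_real[of "x ^ i" A] xi x by simp
        moreover have "real_gf A (x ^ i) \<ge> 0" "real_gf A (x ^ i) \<le> f"
          unfolding f_def using xi x by (auto intro!: real_gf_nonneg real_gf_mono)
        ultimately show ?thesis by simp
      qed
      have "norm (fact k * H - set_gf A (of_real x) ^ k) \<le>
          fact k * (1 + (\<Sum>i=1..k. norm (set_gf A (of_real x ^ i)) ^ (k - 1)))"
        unfolding H_def by (rule rep_gf_approx[OF R]) (use x k in auto)
      also have "\<dots> \<le> fact k * (1 + (\<Sum>i=1..k. F ^ (k - 1)))"
        using fi F1 by (intro mult_left_mono add_left_mono sum_mono power_mono) (auto intro: order.trans)
      finally have 1: "norm (fact k * H - set_gf A (of_real x) ^ k) \<le> fact k * (1 + real k * F ^ (k - 1))" by simp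
      have "fact k * norm H = norm (fact k * H)" by (simp add: norm_mult)
      also have "\<dots> \<le> norm (fact k * H - set_gf A (of_real x) ^ k) + norm (set_gf A (of_real x) ^ k)"
        using norm_triangle_ineq[of "fact k * H - set_gf A (of_real x) ^ k" "set_gf A (of_real x) ^ k"] by simp
      also have "norm (set_gf A (of_real x) ^ k) = f ^ k"
        using f0 by (simp add: set_gf_of_real[OF x] f_def norm_power)
      finally have "fact k * norm H \<le> fact k * (1 + real k * F ^ (k - 1)) + f ^ k" using 1 by linarith
      also have "\<dots> \<le> fact k * (F ^ k + real k * F ^ k) + F ^ k"
        using F1 f0 by (intro add_mono mult_left_mono power_mono power_increasing one_le_power) auto
      also have "\<dots> = D * F ^ k" by (simp add: D_def algebra_simps)
      finally have "fact k * (c * real N / 4) \<le> D * F ^ k"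
        using H by (meson fact_ge_zero mult_left_mono order.trans)
      hence FN: "c' * real N \<le> F ^ k" using D by (simp add: c'_def field_simps)
      hence "F \<noteq> 1" using elim(3) by auto
      hence "F = f" by (auto simp: F_def max_def split: if_splits)
      thus ?case using FN by (simp add: f_def x_def r_def)
    qed
  qed
qed

section \<open>Choice of the parameters and the contradiction\<close>

theorem theorem1:
  fixes k :: nat and c :: real and R :: "nat \<Rightarrow> nat \<Rightarrow> bool"
  assumes "k \<ge> 2" and "c > 0" and "R \<in> {(\<le>), (<)}"
  shows "\<not> (\<exists>A :: nat set.
           (\<lambda>n :: nat. \<Sum>j = 0..n. real (ordered_rep R k A j) - c)
             \<in> o(\<lambda>n. real n powr (1 / 4) * ln (real n) powr (- 1 / 2)))"
proof
  assume "\<exists>A :: nat set.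
           (\<lambda>n :: nat. \<Sum>j = 0..n. real (ordered_rep R k A j) - c)
             \<in> o(\<lambda>n. real n powr (1 / 4) * ln (real n) powr (- 1 / 2))"
  then obtain A where small: "rep_error R k A c \<in> o(\<lambda>n. real n powr (1 / 4) * ln (real n) powr (- 1 / 2))"
    by (auto simp: rep_error_def[abs_def])
  obtain C where C: "C > 0" and upper:
    "\<And>A q r c s E e. 0 \<le> q \<Longrightarrow> q < 1 \<Longrightarrow> 0 \<le> r \<Longrightarrow> r < 1 \<Longrightarrow> c > 0 \<Longrightarrow> s > 0 \<Longrightarrow>
       has_power_series r e E \<Longrightarrow>
       (\<And>z. norm z = r \<Longrightarrow> rep_gf R k A z = of_real c / (1 - z) + (1 - z) * E z) \<Longrightarrow>
       circle_mean r (\<lambda>z. norm (set_gf A z) ^ k * (norm (geom_kernel q z))\<^sup>2) \<le>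
         2 * fact k * (c * (1 / (1 - q))\<^sup>2 * circle_mean r (\<lambda>z. 1 / norm (1 - z)) +
           1 / s * circle_mean r (\<lambda>z. (norm (E z))\<^sup>2)) +
         (2 * fact k * s + C) * circle_mean r (\<lambda>z. (norm (geom_kernel q z))\<^sup>2)"
    using circle_mean_upper[OF assms(3,1)] by blast
  obtain c2 where c2: "c2 > 0" and lower: "eventually (\<lambda>N. real_gf A ((1 - 1 / real N)\<^sup>2) ^ k \<ge> c2 * real N) sequentially"
    using real_gf_lower[OF assms(3,1,2) small] by blast
  \<comment> \<open>The constant in \<open>c1 * sqrt N * T \<le> J\<close>; the power of 2 comes
    from the halving in \<open>circle_mean_lower\<close>.\<close>
  define c1 where "c1 = sqrt (c2 / 2 ^ k)"
  define K :: real where "K = 2 * fact k"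
  \<comment> \<open>Four terms of the upper bound get a budget of \<open>c1 / 8\<close> times
    \<open>sqrt N * T\<close> each: \<open>\<epsilon>\<close> controls the pole,
    \<open>\<eta>\<close> the term with \<open>s\<close>, \<open>\<delta>\<close> the error series,
    and large \<open>N\<close> the term with \<open>C\<close>.\<close>
  define \<epsilon> where "\<epsilon> = c1 / (128 * c * K)"
  define \<eta> where "\<eta> = c1 / (8 * K)"
  define \<delta> where "\<delta> = c1 * \<eta> * \<epsilon> / (64 * K)"
  have pos: "c1 > 0" "K > 0" "\<epsilon> > 0" "\<eta> > 0" "\<delta> > 0"
    using c2 assms by (simp_all add: c1_def K_def \<epsilon>_def \<eta>_def \<delta>_def)
  \<comment> \<open>With \<open>M\<close> as below, \<open>M \<ge> 1\<close> makes \<open>q\<close>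
    nonnegative and \<open>M \<le> N\<close> makes \<open>1 - r\<close> at most
    \<open>1 - q\<close>.\<close>
  have "eventually (\<lambda>N. \<epsilon> * sqrt (real N) / ln (real N) \<ge> 1) sequentially"
    "eventually (\<lambda>N. \<epsilon> * sqrt (real N) / ln (real N) \<le> real N) sequentially"
    "eventually (\<lambda>N. C \<le> c1 / 8 * sqrt (real N)) sequentially"
    using pos by real_asymp+
  with lower rep_error_square_bound[OF small pos(5)] eventually_ge_at_top[of "2::nat"]
  have "eventually (\<lambda>N. False) sequentially"
  proof eventually_elim
    case (elim N)
    define r where "r = 1 - 1 / real N"
    define M where "M = \<epsilon> * sqrt (real N) / ln (real N)"
    define q where "q = 1 - 1 / M"
    define s where "s = \<eta> * sqrt (real N)"
    define T where "T = circle_mean r (\<lambda>z. (norm (geom_kernel q z))\<^sup>2)"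
    define J where "J = circle_mean r (\<lambda>z. norm (set_gf A z) ^ k * (norm (geom_kernel q z))\<^sup>2)"
    define L where "L = circle_mean r (\<lambda>z. 1 / norm (1 - z))"
    define EE where "EE = circle_mean r (\<lambda>z. (norm (error_gf R k A c z))\<^sup>2)"
    have N: "real N \<ge> 2" "sqrt (real N) > 0" "ln (real N) > 0" using elim by auto
    have M: "M \<ge> 1" "M \<le> real N" using elim by (auto simp: M_def)
    have r: "1 / 2 \<le> r" "r < 1" using N by (auto simp: r_def field_simps)
    have q: "0 \<le> q" "q < 1" using M by (auto simp: q_def)
    have s: "s > 0" using pos N by (simp add: s_def)
    have r2: "0 \<le> r\<^sup>2" "r\<^sup>2 < 1" using r by (auto simp: abs_square_less_1)
    have qr: "0 \<le> q * r" "q * r < 1" using q r mult_strict_mono[of q 1 r 1] by auto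
    have T_eq: "T = 1 / (1 - (q * r)\<^sup>2)"
      unfolding T_def by (rule circle_mean_geom_kernel) (use q r in auto)
    \<comment> \<open>Both \<open>1 - q\<close> and \<open>1 - r\<close> are at most
      \<open>1 / M\<close>, so \<open>1 - (q * r)^2\<close> is at most \<open>4 / M\<close>.\<close>
    have T: "M \<le> 4 * T"
    proof -
      have "1 - (q * r)\<^sup>2 = (1 - q * r) * (1 + q * r)" by (simp add: power2_eq_square algebra_simps)
      also have "\<dots> \<le> (1 - q * r) * 2" using qr by (intro mult_left_mono) auto
      also have "1 - q * r = 1 / M * r + 1 / real N" by (simp add: q_def r_def algebra_simps)
      also have "\<dots> \<le> 1 / M * 1 + 1 / M"
        using M r by (intro add_mono mult_left_mono divide_left_mono) auto
      finally have "1 - (q * r)\<^sup>2 \<le> 4 / M" by simp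
      moreover have "1 - (q * r)\<^sup>2 > 0" using qr by (simp add: abs_square_less_1)
      ultimately have "1 / (4 / M) \<le> T" unfolding T_eq using M by (intro divide_left_mono) auto
      thus ?thesis using M by simp
    qed
    hence T0: "T > 0" using M by linarith
    have J_ge: "c1 * sqrt (real N) * T \<le> J"
    proof -
      define f where "f = real_gf A (r\<^sup>2)"
      have f: "f \<ge> 0" unfolding f_def by (rule real_gf_nonneg[OF r2])
      have "c1 * sqrt (real N) = sqrt (c2 * real N / 2 ^ k)"
        by (simp add: c1_def real_sqrt_divide real_sqrt_mult)
      also have "\<dots> \<le> sqrt (f ^ k / 2 ^ k)"
        using elim by (intro real_sqrt_le_mono divide_right_mono) (auto simp: f_def r_def)
      also have "\<dots> = sqrt (f / 2) ^ k" by (simp add: power_divide real_sqrt_power[symmetric])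
      finally have "c1 * sqrt (real N) * T \<le> sqrt (f / 2) ^ k * T" using T0 by (intro mult_right_mono) auto
      also have "\<dots> \<le> J"
        using circle_mean_lower[of q r k A] q r assms(1) by (simp add: T_eq J_def f_def)
      finally show ?thesis .
    qed
    \<comment> \<open>The factor 4 is a bound for \<open>1 / r^2\<close>, as
      \<open>r \<ge> 1 / 2\<close>.\<close>
    have L: "L \<le> 4 * ln (real N)"
    proof -
      have "r\<^sup>2 \<le> r" using r by (simp add: power2_eq_square mult_left_le_one_le)
      hence "1 / real N \<le> 1 - r\<^sup>2" by (simp add: r_def)
      hence "ln (1 / real N) \<le> ln (1 - r\<^sup>2)" using N r2 by (subst ln_le_cancel_iff) auto
      hence "- ln (1 - r\<^sup>2) \<le> ln (real N)" using N by (simp add: ln_div)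
      moreover have "(1 / 2)\<^sup>2 \<le> r\<^sup>2" using r by (intro power_mono) auto
      ultimately have "- ln (1 - r\<^sup>2) / r\<^sup>2 \<le> ln (real N) / (1 / 2)\<^sup>2"
        using N r by (intro frac_le) auto
      thus ?thesis unfolding L_def
        using circle_mean_inverse_one_minus[of r] r by (simp add: power2_eq_square)
    qed
    have EE: "EE \<le> 2 * \<delta> * (real N * sqrt (real N)) / ln (real N)"
      unfolding EE_def r_def by (rule error_gf_bounds(1)) (use elim pos in auto)
    have "J \<le> K * (c * (1 / (1 - q))\<^sup>2 * L + 1 / s * EE) + (K * s + C) * T"
      unfolding J_def K_def L_def EE_def T_def
      by (rule upper[OF q _ r(2) assms(2) s has_power_series_error_gf])
         (use r in \<open>auto intro!: rep_gf_eq_error_gf\<close>)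
    also have "1 / (1 - q) = M" by (simp add: q_def)
    finally have J_le: "J \<le> K * (c * M\<^sup>2 * L + 1 / s * EE) + (K * s + C) * T" .
    \<comment> \<open>The logarithm in \<open>L\<close> cancels against the one in the denominator
      of \<open>M\<close>, leaving \<open>\<epsilon> * sqrt N\<close>; the other factor
      \<open>M\<close> is at most \<open>4 * T\<close>.\<close>
    have "c * M\<^sup>2 * L \<le> 16 * c * \<epsilon> * (sqrt (real N) * T)"
    proof -
      have "c * M\<^sup>2 * L \<le> c * M\<^sup>2 * (4 * ln (real N))"
        using L assms by (intro mult_left_mono) auto
      also have "\<dots> = 4 * c * (M * ln (real N)) * M" by (simp add: power2_eq_square)
      also have "M * ln (real N) = \<epsilon> * sqrt (real N)" using N by (simp add: M_def)
      also have "4 * c * (\<epsilon> * sqrt (real N)) * M \<le> 4 * c * (\<epsilon> * sqrt (real N)) * (4 * T)"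
        using T pos assms by (intro mult_left_mono) auto
      finally show ?thesis by (simp add: algebra_simps)
    qed
    \<comment> \<open>Dividing by \<open>s\<close> leaves \<open>N / ln N\<close>, which is
      \<open>sqrt N * M / \<epsilon>\<close>. Here the exponents \<open>1/4\<close> and
      \<open>-1/2\<close> of the theorem are exactly spent.\<close>
    moreover have "1 / s * EE \<le> 8 * \<delta> / (\<eta> * \<epsilon>) * (sqrt (real N) * T)"
    proof -
      have "1 / s * EE \<le> 1 / s * (2 * \<delta> * (real N * sqrt (real N)) / ln (real N))"
        using EE s by (intro mult_left_mono) auto
      also have "\<dots> = 2 * \<delta> / \<eta> * (real N / ln (real N))"
        using N pos by (simp add: s_def field_simps)
      also have "real N / ln (real N) = sqrt (real N) * M / \<epsilon>"
        using pos by (simp add: M_def)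
      also have "2 * \<delta> / \<eta> * (sqrt (real N) * M / \<epsilon>) \<le> 2 * \<delta> / \<eta> * (sqrt (real N) * (4 * T) / \<epsilon>)"
        using T pos by (intro mult_left_mono divide_right_mono) auto
      also have "\<dots> = 8 * \<delta> / (\<eta> * \<epsilon>) * (sqrt (real N) * T)" by (simp add: field_simps)
      finally show ?thesis .
    qed
    ultimately have "K * (c * M\<^sup>2 * L + 1 / s * EE) \<le>
        K * (16 * c * \<epsilon> * (sqrt (real N) * T) + 8 * \<delta> / (\<eta> * \<epsilon>) * (sqrt (real N) * T))"
      using pos by (intro mult_left_mono add_mono) auto
    also have "\<dots> = (K * 16 * c * \<epsilon> + K * 8 * \<delta> / (\<eta> * \<epsilon>)) * (sqrt (real N) * T)"
      by (simp add: algebra_simps)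
    also have "K * 16 * c * \<epsilon> = c1 / 8" using pos assms by (simp add: \<epsilon>_def field_simps)
    also have "K * 8 * \<delta> / (\<eta> * \<epsilon>) = c1 / 8"
    proof -
      have "\<eta> \<noteq> 0" "\<epsilon> \<noteq> 0" "K \<noteq> 0" using pos by auto
      thus ?thesis unfolding \<delta>_def by (simp add: field_simps)
    qed
    finally have a: "K * (c * M\<^sup>2 * L + 1 / s * EE) \<le> (c1 / 8 + c1 / 8) * (sqrt (real N) * T)" .
    have "K * s = c1 / 8 * sqrt (real N)" using pos by (simp add: s_def \<eta>_def)
    hence "(K * s + C) * T \<le> (c1 / 8 * sqrt (real N) + c1 / 8 * sqrt (real N)) * T"
      using elim T0 by (intro mult_right_mono) auto
    also have "\<dots> = (c1 / 8 + c1 / 8) * (sqrt (real N) * T)" by (simp add: algebra_simps)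
    \<comment> \<open>Four eighths of \<open>c1\<close> stand against the full \<open>c1\<close> of
      the lower bound.\<close>
    finally have "J \<le> (c1 / 8 + c1 / 8) * (sqrt (real N) * T) + (c1 / 8 + c1 / 8) * (sqrt (real N) * T)"
      using J_le a by linarith
    hence "J \<le> c1 / 2 * (sqrt (real N) * T)" by (simp add: algebra_simps)
    moreover have "0 < c1 * (sqrt (real N) * T)" using pos N T0 by (intro mult_pos_pos) auto
    ultimately show False using J_ge by (simp add: mult.assoc)
  qed
  thus False by simp
qed

end
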